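(* Let $V$ be a finite-dimensional complex vector space, $R=\mathbb{C}[V]$, and let $G\subset G'\subset \mathrm{GL}(V)$ be reductive groups where $G'$ is connected. Let $\pi\colon V\to V/\!\!/G$ and $\pi'\colon V\to V/\!\!/G'$ be the categorical quotient maps. Suppose that there is a fiber $F$ of $\pi$ which is also a fiber of $\pi'$ (as sets). Then $R^G=R^{G'}$.
   Context: The base field is $\mathbb{C}$. "Reductive group" means a reductive (Zariski closed, possibly disconnected) complex linear algebraic group. For a reductive group $G\subset\mathrm{GL}(V)$, $V/\!\!/G$ is the affine variety with coordinate ring $R^G$ (the $G$-invariant polynomials), and $\pi\colon V\to V/\!\!/G$ is the morphism dual to the inclusion $R^G\subset R$; similarly for $G'$. *)

theory Defs
  imports
    "HOL-Analysis.Abstract_Topology"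
    "HOL-Algebra.Group"
    "Jordan_Normal_Form.VS_Connect"
begin

text \<open>
  A complex vector space \<open>V\<close> is given by a type \<open>'v\<close> and its scalar multiplication \<open>s\<close>.
  Polynomial and regular functions are represented as complex-valued functions, which is
  harmless because \<open>\<complex>\<close> is infinite.
\<close>

inductive_set generated_algebra :: "('x \<Rightarrow> complex) set \<Rightarrow> ('x \<Rightarrow> complex) set"
  for S :: "('x \<Rightarrow> complex) set" where
  gen: "f \<in> S \<Longrightarrow> f \<in> generated_algebra S"
| const: "(\<lambda>_. c) \<in> generated_algebra S"
| add: "f \<in> generated_algebra S \<Longrightarrow> h \<in> generated_algebra S \<Longrightarrow>
    (\<lambda>x. f x + h x) \<in> generated_algebra S"
| mult: "f \<in> generated_algebra S \<Longrightarrow> h \<in> generated_algebra S \<Longrightarrow>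
    (\<lambda>x. f x * h x) \<in> generated_algebra S"

definition dual_space ::
    "(complex \<Rightarrow> 'v::ab_group_add \<Rightarrow> 'v) \<Rightarrow> ('v \<Rightarrow> complex) set" where
  "dual_space s = {\<phi>. Vector_Spaces.linear s (*) \<phi>}"

definition polynomial_functions ::
    "(complex \<Rightarrow> 'v::ab_group_add \<Rightarrow> 'v) \<Rightarrow> ('v \<Rightarrow> complex) set" where
  "polynomial_functions s = generated_algebra (dual_space s)"

definition GL :: "(complex \<Rightarrow> 'v::ab_group_add \<Rightarrow> 'v) \<Rightarrow> ('v \<Rightarrow> 'v) monoid" where
  "GL s = \<lparr>carrier = {g. Vector_Spaces.linear s s g \<and> bij g}, mult = (\<circ>), one = id\<rparr>"

text \<open>
  The coordinate ring \<open>\<complex>[GL(V)] = \<complex>[g\<^sub>i\<^sub>j, 1/det g]\<close>, without choosing a basis: it is generated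
  by the matrix coefficients of \<open>g\<close> and of its inverse (\<open>1/det g\<close> is a polynomial in the latter,
  and conversely by Cramer's rule). Only the values on \<open>carrier (GL s)\<close> matter.
\<close>

definition regular_functions_GL ::
    "(complex \<Rightarrow> 'v::ab_group_add \<Rightarrow> 'v) \<Rightarrow> (('v \<Rightarrow> 'v) \<Rightarrow> complex) set" where
  "regular_functions_GL s = generated_algebra
     ({(\<lambda>g. \<phi> (g v)) | \<phi> v. \<phi> \<in> dual_space s} \<union>
      {(\<lambda>g. \<phi> ((inv\<^bsub>GL s\<^esub> g) v)) | \<phi> v. \<phi> \<in> dual_space s})"

definition zariski_GL ::
    "(complex \<Rightarrow> 'v::ab_group_add \<Rightarrow> 'v) \<Rightarrow> ('v \<Rightarrow> 'v) topology" where
  "zariski_GL s = topology_generated_by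
     {{g \<in> carrier (GL s). p g \<noteq> 0} | p. p \<in> regular_functions_GL s}"

definition rational_representation ::
    "(complex \<Rightarrow> 'v::ab_group_add \<Rightarrow> 'v) \<Rightarrow> ('v \<Rightarrow> 'v) set \<Rightarrow> nat \<Rightarrow>
      (('v \<Rightarrow> 'v) \<Rightarrow> complex mat) \<Rightarrow> bool" where
  "rational_representation s G m \<rho> \<longleftrightarrow>
     \<rho> \<in> hom ((GL s)\<lparr>carrier := G\<rparr>) (units_of (ring_mat TYPE(complex) m ())) \<and>
     (\<forall>i<m. \<forall>j<m. \<exists>p\<in>regular_functions_GL s. \<forall>g\<in>G. \<rho> g $$ (i, j) = p g)"

definition stable_subspace ::
    "'g set \<Rightarrow> nat \<Rightarrow> ('g \<Rightarrow> complex mat) \<Rightarrow> complex vec set \<Rightarrow> bool" where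
  "stable_subspace G m \<rho> U \<longleftrightarrow>
     VectorSpace.subspace class_ring U (module_vec TYPE(complex) m) \<and>
     (\<forall>g\<in>G. \<forall>u\<in>U. \<rho> g *\<^sub>v u \<in> U)"

definition completely_reducible ::
    "'g set \<Rightarrow> nat \<Rightarrow> ('g \<Rightarrow> complex mat) \<Rightarrow> bool" where
  "completely_reducible G m \<rho> \<longleftrightarrow>
     (\<forall>U. stable_subspace G m \<rho> U \<longrightarrow>
       (\<exists>W. stable_subspace G m \<rho> W \<and> U \<inter> W = {0\<^sub>v m} \<and>
            (\<forall>x\<in>carrier_vec m. \<exists>u\<in>U. \<exists>w\<in>W. x = u + w)))"

text \<open>
  Reductivity is taken in the sense customary for linear algebraic groups over \<open>\<complex>\<close> in invariant
  theory (e.g. Goodman and Wallach, Symmetry, Representations, and Invariants): every rational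
  representation is completely reducible. No connectedness is assumed.
\<close>

definition reductive_group ::
    "(complex \<Rightarrow> 'v::ab_group_add \<Rightarrow> 'v) \<Rightarrow> ('v \<Rightarrow> 'v) set \<Rightarrow> bool" where
  "reductive_group s G \<longleftrightarrow>
     subgroup G (GL s) \<and> closedin (zariski_GL s) G \<and>
     (\<forall>m \<rho>. rational_representation s G m \<rho> \<longrightarrow> completely_reducible G m \<rho>)"

definition invariants ::
    "(complex \<Rightarrow> 'v::ab_group_add \<Rightarrow> 'v) \<Rightarrow> ('v \<Rightarrow> 'v) set \<Rightarrow> ('v \<Rightarrow> complex) set" where
  "invariants s G = {f \<in> polynomial_functions s. \<forall>g\<in>G. \<forall>v. f (g v) = f v}"

text \<open>
  The points of the affine variety with coordinate ring \<open>R\<^sup>G\<close>: the \<open>\<complex>\<close>-algebra homomorphisms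
  \<open>R\<^sup>G \<rightarrow> \<complex>\<close>, made unique as functions by \<open>extensional\<close>. The morphism dual to
  \<open>R\<^sup>G \<subseteq> R\<close> then sends \<open>v\<close> to evaluation at \<open>v\<close>. Surjectivity of this morphism is not built in.
\<close>

definition categorical_quotient ::
    "(complex \<Rightarrow> 'v::ab_group_add \<Rightarrow> 'v) \<Rightarrow> ('v \<Rightarrow> 'v) set \<Rightarrow> (('v \<Rightarrow> complex) \<Rightarrow> complex) set" where
  "categorical_quotient s G = {\<xi> \<in> extensional (invariants s G).
     (\<forall>c. \<xi> (\<lambda>_. c) = c) \<and>
     (\<forall>f\<in>invariants s G. \<forall>h\<in>invariants s G.
        \<xi> (\<lambda>v. f v + h v) = \<xi> f + \<xi> h \<and> \<xi> (\<lambda>v. f v * h v) = \<xi> f * \<xi> h)}"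

definition categorical_quotient_map ::
    "(complex \<Rightarrow> 'v::ab_group_add \<Rightarrow> 'v) \<Rightarrow> ('v \<Rightarrow> 'v) set \<Rightarrow> 'v \<Rightarrow> ('v \<Rightarrow> complex) \<Rightarrow> complex" where
  "categorical_quotient_map s G v = restrict (\<lambda>f. f v) (invariants s G)"

definition is_quotient_fiber ::
    "(complex \<Rightarrow> 'v::ab_group_add \<Rightarrow> 'v) \<Rightarrow> ('v \<Rightarrow> 'v) set \<Rightarrow> 'v set \<Rightarrow> bool" where
  "is_quotient_fiber s G F \<longleftrightarrow> (\<exists>\<xi>\<in>categorical_quotient s G. F = categorical_quotient_map s G -` {\<xi>})"

end

theory Submission
  imports Defs
    "HOL-Library.Function_Algebras"
    "HOL-Computational_Algebra.Fundamental_Theorem_Algebra"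
    "HOL-Analysis.Continuum_Not_Denumerable"
begin

text \<open>
  Put \<open>A = R\<^sup>G\<^sup>' \<subseteq> B = R\<^sup>G\<close>, let \<open>v\<close> be a point of the common fibre, and let \<open>m\<^sub>A\<close>,
  \<open>m\<^sub>B\<close> be the maximal ideals of \<open>A\<close>, \<open>B\<close> at \<open>v\<close>. Since every extended ideal of \<open>B\<close> contracts
  back, equality of the fibres and the Nullstellensatz make every element of \<open>m\<^sub>B\<close> nilpotent modulo
  \<open>m\<^sub>A B\<close>, so that \<open>B / m\<^sub>A B\<close> is finite-dimensional, say of dimension at most \<open>r\<close>. Hence for
  every \<open>k\<close> an element \<open>f\<close> of \<open>B\<close> acts on \<open>r\<close> generators by a matrix over \<open>A\<close> modulo
  \<open>m\<^sub>A\<^sup>k B\<close>. The translates of \<open>f\<close> by \<open>G'\<close> satisfy the same congruences, because \<open>G'\<close> fixes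
  \<open>A\<close>; restricted to lines through \<open>v\<close> they are eigenvalues of one \<open>r \<times> r\<close> matrix up to any
  order, so there are at most \<open>r\<close> of them. As \<open>G'\<close> is connected, the finite orbit of \<open>f\<close> is a
  single point.
\<close>

subsection \<open>Noetherian subrings\<close>

text \<open>A priori \<open>B\<close> is not a finite module over \<open>A\<close>; finiteness is
  available only modulo powers of m_A, so no exact equation for \<open>f\<close> over
  \<open>A\<close> can be written down. Lines through \<open>v\<close> repair this: on them an
  element of m_A^k B becomes divisible by z^k, and a polynomial divisible by every z^k is zero. A
  linear relation among the approximate eigenvectors therefore stays exact when its terms are
  multiplied by the eigenvalues. The matrix may change with k; only its size and the vectors are
  fixed. The translates of \<open>f\<close> may leave \<open>B\<close>, and \<open>G'\<close> need
  not fix \<open>v\<close>. What survives translation is that an invariant of \<open>G'\<close>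
  vanishing at \<open>v\<close> is unchanged by it, so orders of vanishing at \<open>v\<close> are
  kept. Ideals contract because coefficient tuples of bounded degree form a rational representation
  of \<open>G\<close>, in which the tuples of relations have a stable complement. The same
  contraction supplies the point \<open>v\<close>: if the fibre were empty, 1 would lie in the
  kernel of a character of \<open>B\<close>.\<close>

inductive_set ideal_span :: "'r::comm_ring_1 set \<Rightarrow> 'r set \<Rightarrow> 'r set" for S X where
  zero: "0 \<in> ideal_span S X"
| step: "c \<in> S \<Longrightarrow> x \<in> X \<Longrightarrow> f \<in> ideal_span S X \<Longrightarrow> c * x + f \<in> ideal_span S X"

text \<open>Generators are selected from \<open>X\<close> itself, so an ideal of \<open>R\<close>
  spanned by invariants is spanned by finitely many of those invariants.\<close>

definition noetherian :: "'r::comm_ring_1 set \<Rightarrow> bool" where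
  "noetherian S \<longleftrightarrow> (\<forall>X. X \<subseteq> S \<longrightarrow> (\<exists>Y. Y \<subseteq> X \<and> finite Y \<and> X \<subseteq> ideal_span S Y))"

lemma ideal_span_add:
  "f \<in> ideal_span S X \<Longrightarrow> g \<in> ideal_span S X \<Longrightarrow> f + g \<in> ideal_span S X"
  by (induction rule: ideal_span.induct) (auto simp: add.assoc intro: ideal_span.intros)

lemma ideal_span_mult:
  assumes "\<And>a b. a \<in> S \<Longrightarrow> b \<in> S \<Longrightarrow> a * b \<in> S" "c \<in> S" "f \<in> ideal_span S X"
  shows "c * f \<in> ideal_span S X"
  using assms(3)
proof induction
  case zero
  then show ?case by (simp add: ideal_span.zero)
next
  case (step d x f)
  then have "(c * d) * x + c * f \<in> ideal_span S X"
    using assms by (intro ideal_span.step) auto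
  then show ?case by (simp add: algebra_simps)
qed

lemma ideal_span_base:
  assumes "1 \<in> S" "x \<in> X"
  shows "x \<in> ideal_span S X"
  using ideal_span.step[OF assms ideal_span.zero] by simp

lemma ideal_span_subset:
  assumes "\<And>a b. a \<in> S \<Longrightarrow> b \<in> S \<Longrightarrow> a * b \<in> S" "X \<subseteq> ideal_span S Y"
  shows "ideal_span S X \<subseteq> ideal_span S Y"
proof
  fix f assume "f \<in> ideal_span S X"
  then show "f \<in> ideal_span S Y"
    by induction (use assms in \<open>auto intro!: ideal_span.zero ideal_span_add ideal_span_mult\<close>)
qed

lemma ideal_span_mono:
  assumes "S \<subseteq> T" "X \<subseteq> Y"
  shows "ideal_span S X \<subseteq> ideal_span T Y"
proof
  fix f assume "f \<in> ideal_span S X"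
  then show "f \<in> ideal_span T Y"
    by induction (use assms in \<open>auto intro: ideal_span.intros\<close>)
qed

lemma ideal_span_finite_support:
  assumes "f \<in> ideal_span S X"
  shows "\<exists>Y. Y \<subseteq> X \<and> finite Y \<and> f \<in> ideal_span S Y"
  using assms
proof induction
  case zero
  then show ?case by (intro exI[of _ "{}"]) (simp add: ideal_span.zero)
next
  case (step c x f)
  then obtain Y where "Y \<subseteq> X" "finite Y" "f \<in> ideal_span S Y" by blast
  with step show ?case
    using ideal_span_mono[of S S Y "insert x Y"]
    by (intro exI[of _ "insert x Y"]) (auto intro: ideal_span.step)
qed

locale subring_set =
  fixes S :: "'r::comm_ring_1 set"
  assumes one_mem: "1 \<in> S"
    and diff_mem: "a \<in> S \<Longrightarrow> b \<in> S \<Longrightarrow> a - b \<in> S"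
    and mult_mem: "a \<in> S \<Longrightarrow> b \<in> S \<Longrightarrow> a * b \<in> S"
begin

lemma zero_mem: "0 \<in> S"
  using diff_mem[OF one_mem one_mem] by simp

lemma uminus_mem: "a \<in> S \<Longrightarrow> - a \<in> S"
  using diff_mem[OF zero_mem] by simp

lemma add_mem: "a \<in> S \<Longrightarrow> b \<in> S \<Longrightarrow> a + b \<in> S"
  using diff_mem[of a "- b"] uminus_mem by simp

lemma power_mem: "a \<in> S \<Longrightarrow> a ^ n \<in> S"
  by (induction n) (auto intro: one_mem mult_mem)

lemma sum_mem: "(\<And>i. i \<in> I \<Longrightarrow> h i \<in> S) \<Longrightarrow> sum h I \<in> S"
  by (induction I rule: infinite_finite_induct) (auto intro: zero_mem add_mem)

lemmas span_add = ideal_span_add[of _ S]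
lemmas span_base = ideal_span_base[OF one_mem]

lemma span_mult: "c \<in> S \<Longrightarrow> f \<in> ideal_span S X \<Longrightarrow> c * f \<in> ideal_span S X"
  by (rule ideal_span_mult) (auto intro: mult_mem)

lemma span_subset: "X \<subseteq> ideal_span S Y \<Longrightarrow> ideal_span S X \<subseteq> ideal_span S Y"
  by (rule ideal_span_subset) (auto intro: mult_mem)

lemma span_diff:
  assumes "f \<in> ideal_span S X" "g \<in> ideal_span S X"
  shows "f - g \<in> ideal_span S X"
  using span_add[OF assms(1) span_mult[OF uminus_mem[OF one_mem] assms(2)]] by simp

lemma span_mult_base:
  assumes "c \<in> S" "x \<in> X"
  shows "c * x \<in> ideal_span S X"
  using span_mult[OF assms(1) span_base[OF assms(2)]] .

lemma span_sum: "(\<And>i. i \<in> I \<Longrightarrow> h i \<in> ideal_span S X) \<Longrightarrow> sum h I \<in> ideal_span S X"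
  by (induction I rule: infinite_finite_induct) (auto intro: ideal_span.zero span_add)

lemma span_carrier: "X \<subseteq> S \<Longrightarrow> ideal_span S X \<subseteq> S"
proof
  fix f assume "X \<subseteq> S" "f \<in> ideal_span S X"
  from this(2,1) show "f \<in> S"
    by induction (auto intro: zero_mem add_mem mult_mem)
qed

lemma span_finite_iff:
  assumes "finite Y"
  shows "f \<in> ideal_span S Y \<longleftrightarrow> (\<exists>h. (\<forall>y\<in>Y. h y \<in> S) \<and> f = (\<Sum>y\<in>Y. h y * y))"
proof
  assume "f \<in> ideal_span S Y"
  then show "\<exists>h. (\<forall>y\<in>Y. h y \<in> S) \<and> f = (\<Sum>y\<in>Y. h y * y)"
  proof induction
    case zero
    then show ?case by (intro exI[of _ "\<lambda>_. 0"]) (simp add: zero_mem)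
  next
    case (step c x f)
    then obtain h where h: "\<forall>y\<in>Y. h y \<in> S" "f = (\<Sum>y\<in>Y. h y * y)" by blast
    have "(\<Sum>y\<in>Y. (h y + (if y = x then c else 0)) * y) =
        (\<Sum>y\<in>Y. h y * y + (if y = x then c * x else 0))"
      by (intro sum.cong) (auto simp: algebra_simps)
    also have "\<dots> = c * x + f"
      using step assms by (simp add: sum.distrib h)
    finally show ?case
      using h step by (intro exI[of _ "\<lambda>y. h y + (if y = x then c else 0)"])
        (auto intro!: add_mem zero_mem)
  qed
next
  assume "\<exists>h. (\<forall>y\<in>Y. h y \<in> S) \<and> f = (\<Sum>y\<in>Y. h y * y)"
  then show "f \<in> ideal_span S Y" by (auto intro!: span_sum span_mult_base)
qed

lemma span_insert:
  assumes "f \<in> ideal_span S (insert t X)"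
  shows "\<exists>q\<in>S. f - q * t \<in> ideal_span S X"
  using assms
proof induction
  case zero
  then show ?case by (intro bexI[of _ 0]) (auto simp: zero_mem ideal_span.zero)
next
  case (step c x f)
  then obtain q where q: "q \<in> S" "f - q * t \<in> ideal_span S X" by blast
  show ?case
  proof (cases "x = t")
    case True
    then show ?thesis using q step
      by (intro bexI[of _ "c + q"]) (auto simp: algebra_simps intro: add_mem)
  next
    case False
    then have "c * x + (f - q * t) \<in> ideal_span S X"
      using step q by (auto intro: ideal_span.step)
    then show ?thesis using q by (intro bexI[of _ q]) (auto simp: algebra_simps)
  qed
qed

end

section \<open>Polynomials in one element over a subring, and the Hilbert basis theorem\<close>

primrec polys_below :: "'r::comm_ring_1 set \<Rightarrow> 'r \<Rightarrow> nat \<Rightarrow> 'r set" where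
  "polys_below S t 0 = {0}"
| "polys_below S t (Suc n) = {a * t ^ n + f | a f. a \<in> S \<and> f \<in> polys_below S t n}"

definition adjoin :: "'r::comm_ring_1 set \<Rightarrow> 'r \<Rightarrow> 'r set" where
  "adjoin S t = (\<Union>n. polys_below S t n)"

context subring_set
begin

lemma polys_below_Suc: "f \<in> polys_below S t n \<Longrightarrow> f \<in> polys_below S t (Suc n)"
  using zero_mem by force

lemma polys_below_mono: "n \<le> m \<Longrightarrow> polys_below S t n \<subseteq> polys_below S t m"
  by (rule lift_Suc_mono_le[of "polys_below S t"]) (auto simp del: polys_below.simps intro: polys_below_Suc)

lemma polys_below_diff:
  "f \<in> polys_below S t n \<Longrightarrow> g \<in> polys_below S t n \<Longrightarrow> f - g \<in> polys_below S t n"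
proof (induction n arbitrary: f g)
  case (Suc n)
  then obtain a f' b g' where "f = a * t ^ n + f'" "g = b * t ^ n + g'"
    "a \<in> S" "b \<in> S" "f' \<in> polys_below S t n" "g' \<in> polys_below S t n" by auto
  then have "f - g = (a - b) * t ^ n + (f' - g')" "a - b \<in> S" "f' - g' \<in> polys_below S t n"
    using Suc.IH by (simp_all add: algebra_simps diff_mem)
  then show ?case by auto
qed auto

lemma zero_polys_below: "0 \<in> polys_below S t n"
  by (induction n) (auto intro!: exI[of _ 0] simp: zero_mem)

lemma polys_below_add:
  "f \<in> polys_below S t n \<Longrightarrow> g \<in> polys_below S t n \<Longrightarrow> f + g \<in> polys_below S t n"
  using polys_below_diff[of f t n "0 - g"] polys_below_diff[of 0 t n g] zero_polys_below by simp

lemma polys_below_scale: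
  "c \<in> S \<Longrightarrow> f \<in> polys_below S t n \<Longrightarrow> c * f \<in> polys_below S t n"
proof (induction n arbitrary: f)
  case (Suc n)
  then obtain a f' where "f = a * t ^ n + f'" "a \<in> S" "f' \<in> polys_below S t n" by auto
  then have "c * f = (c * a) * t ^ n + c * f'" "c * a \<in> S" "c * f' \<in> polys_below S t n"
    using Suc.IH[of f'] Suc.prems(1) by (simp_all add: distrib_left mult.assoc mult_mem)
  then show ?case by auto
qed auto

lemma polys_below_shift:
  "f \<in> polys_below S t n \<Longrightarrow> t ^ k * f \<in> polys_below S t (n + k)"
proof (induction n arbitrary: f)
  case 0
  then show ?case by (simp add: zero_polys_below)
next
  case (Suc n)
  then obtain a f' where "f = a * t ^ n + f'" "a \<in> S" "f' \<in> polys_below S t n" by auto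
  then have "t ^ k * f = a * t ^ (n + k) + t ^ k * f'" "t ^ k * f' \<in> polys_below S t (n + k)"
    using Suc.IH by (simp_all add: algebra_simps power_add)
  then show ?case using \<open>a \<in> S\<close> by auto
qed

lemma polys_below_mult:
  "f \<in> polys_below S t n \<Longrightarrow> g \<in> polys_below S t m \<Longrightarrow> f * g \<in> polys_below S t (m + n)"
proof (induction n arbitrary: f)
  case 0
  then show ?case by (simp add: zero_polys_below)
next
  case (Suc n)
  then obtain a f' where f: "f = a * t ^ n + f'" "a \<in> S" "f' \<in> polys_below S t n" by auto
  then have "a * (t ^ n * g) \<in> polys_below S t (m + n)" "f' * g \<in> polys_below S t (m + n)"
    using Suc by (auto intro: polys_below_scale polys_below_shift)
  then have "a * (t ^ n * g) + f' * g \<in> polys_below S t (m + n)"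
    by (rule polys_below_add)
  then have "f * g \<in> polys_below S t (m + n)" by (simp add: f algebra_simps)
  then show ?case by (simp only: add_Suc_right polys_below_Suc)
qed

lemma subset_adjoin: "S \<subseteq> adjoin S t"
proof
  fix a assume "a \<in> S"
  then have "a \<in> polys_below S t 1" by simp
  then show "a \<in> adjoin S t" unfolding adjoin_def by blast
qed

lemma gen_adjoin: "t \<in> adjoin S t"
proof -
  have "t = 1 * t ^ 1 + 0" "0 \<in> polys_below S t 1" by (simp_all only: zero_polys_below) simp
  then have "t \<in> polys_below S t (Suc 1)" unfolding polys_below.simps(2) using one_mem by blast
  then show ?thesis unfolding adjoin_def by blast
qed

lemma subring_adjoin: "subring_set (adjoin S t)"
proof
  show "1 \<in> adjoin S t" using one_mem subset_adjoin by blast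
  fix a b assume "a \<in> adjoin S t" "b \<in> adjoin S t"
  then obtain n m where nm: "a \<in> polys_below S t n" "b \<in> polys_below S t m"
    unfolding adjoin_def by blast
  then have "a \<in> polys_below S t (max n m)" "b \<in> polys_below S t (max n m)"
    using polys_below_mono[of _ "max n m" t] by (meson max.cobounded1 max.cobounded2 subsetD)+
  then show "a - b \<in> adjoin S t" unfolding adjoin_def by (blast intro: polys_below_diff)
  have "a * b \<in> polys_below S t (m + n)" using nm by (rule polys_below_mult)
  then show "a * b \<in> adjoin S t" unfolding adjoin_def by blast
qed

end

text \<open>The leading-coefficient argument. Since \<open>t\<close> may satisfy relations over
  \<open>S\<close>, an element has no well-defined degree; \<open>L n\<close> collects every
  \<open>a\<close> such that some element of the ideal can be written as \<open>a * t ^ n\<close>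
  plus lower terms, and the induction runs over the level of a representation.\<close>

theorem hilbert_basis:
  assumes "subring_set S" "noetherian S"
  shows "noetherian (adjoin S t)"
  unfolding noetherian_def
proof (intro allI impI)
  interpret S: subring_set S by fact
  interpret T: subring_set "adjoin S t" by (rule S.subring_adjoin)
  fix X assume X: "X \<subseteq> adjoin S t"
  define I where "I = ideal_span (adjoin S t) X"
  define L where "L n = {a \<in> S. \<exists>f\<in>polys_below S t n. a * t ^ n + f \<in> I}" for n
  have I_mult: "c * f \<in> I" if "c \<in> adjoin S t" "f \<in> I" for c f
    using that T.span_mult unfolding I_def by blast
  have I_add: "f + g \<in> I" "f - g \<in> I" if "g \<in> I" "f \<in> I" for f g
    using that T.span_add T.span_diff unfolding I_def by blast+
  have t_pow: "t ^ n \<in> adjoin S t" for n by (intro T.power_mem S.gen_adjoin)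
  have L_mono: "L n \<subseteq> L m" if "n \<le> m" for n m
  proof
    fix a assume "a \<in> L n"
    then obtain f where f: "a \<in> S" "f \<in> polys_below S t n" "a * t ^ n + f \<in> I"
      unfolding L_def by blast
    have "t ^ (m - n) * (a * t ^ n + f) \<in> I" by (intro I_mult t_pow f)
    moreover have "t ^ (m - n) * (a * t ^ n + f) = a * t ^ m + t ^ (m - n) * f"
      using that by (simp add: algebra_simps flip: power_add)
    moreover have "t ^ (m - n) * f \<in> polys_below S t m"
      using S.polys_below_shift[OF f(2), of "m - n"] that by simp
    ultimately show "a \<in> L m" unfolding L_def using f by auto
  qed
  have L_ideal: "ideal_span S Y \<subseteq> L n" if "Y \<subseteq> L n" for Y n
  proof
    fix a assume "a \<in> ideal_span S Y"
    then show "a \<in> L n"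
    proof induction
      case zero
      have "0 \<in> I" unfolding I_def by (rule ideal_span.zero)
      then show ?case unfolding L_def
        by (auto simp: S.zero_mem intro!: bexI[of _ 0] S.zero_polys_below)
    next
      case (step c x a)
      from step.hyps that have "x \<in> L n" by blast
      then obtain f where f: "x \<in> S" "f \<in> polys_below S t n" "x * t ^ n + f \<in> I"
        unfolding L_def by blast
      from step.IH obtain g where g: "a \<in> S" "g \<in> polys_below S t n" "a * t ^ n + g \<in> I"
        unfolding L_def by blast
      have "c * (x * t ^ n + f) + (a * t ^ n + g) \<in> I"
        using step S.subset_adjoin[of t] by (intro I_add I_mult f g) auto
      then have "(c * x + a) * t ^ n + (c * f + g) \<in> I" by (simp add: algebra_simps)
      moreover have "c * f + g \<in> polys_below S t n"
        using f g step by (intro S.polys_below_add S.polys_below_scale)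
      ultimately show ?case unfolding L_def
        using f g step by (auto intro: S.add_mem S.mult_mem)
    qed
  qed
  have L_S: "L n \<subseteq> S" for n unfolding L_def by blast
  have "(\<Union>n. L n) \<subseteq> S" using L_S by blast
  then obtain Y where Y: "Y \<subseteq> (\<Union>n. L n)" "finite Y" "(\<Union>n. L n) \<subseteq> ideal_span S Y"
    using assms(2) unfolding noetherian_def by meson
  have "\<exists>N. Y \<subseteq> L N"
    using Y(2,1)
  proof (induction rule: finite_induct)
    case (insert y Y)
    then obtain N n where "Y \<subseteq> L N" "y \<in> L n" by auto
    then have "insert y Y \<subseteq> L (max n N)" using L_mono[of n "max n N"] L_mono[of N "max n N"] by auto
    then show ?case by blast
  qed auto
  then obtain N where N: "Y \<subseteq> L N" by blast
  have "L n \<subseteq> L N" for n using Y(3) L_ideal[OF N] by blast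
  then have L_min: "L n \<subseteq> L (min n N)" for n by (cases "n \<le> N") (auto simp: min_def)
  have "\<exists>Y. \<forall>n. Y n \<subseteq> L n \<and> finite (Y n) \<and> L n \<subseteq> ideal_span S (Y n)"
    using assms(2) L_S unfolding noetherian_def by meson
  then obtain G where G: "\<And>n. G n \<subseteq> L n" "\<And>n. finite (G n)" "\<And>n. L n \<subseteq> ideal_span S (G n)"
    by blast
  have "\<forall>n a. \<exists>f. a \<in> L n \<longrightarrow> f \<in> polys_below S t n \<and> a * t ^ n + f \<in> I"
    unfolding L_def by blast
  then obtain \<phi> where \<phi>: "\<And>n a. a \<in> L n \<Longrightarrow> \<phi> n a \<in> polys_below S t n \<and> a * t ^ n + \<phi> n a \<in> I"
    by metis
  \<comment> \<open>The ideals \<open>L n\<close> are stationary from \<open>N\<close> on, so one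
    element of \<open>I\<close> for each chosen leading coefficient up to level \<open>N\<close> is
    enough.\<close>
  define Z where "Z = (\<Union>n\<le>N. (\<lambda>a. a * t ^ n + \<phi> n a) ` G n)"
  have "finite Z" unfolding Z_def using G by auto
  have Z_I: "Z \<subseteq> I" unfolding Z_def using \<phi> G(1) by blast
  \<comment> \<open>A generator of level \<open>k\<close> is shifted to level \<open>n\<close> by
    the factor \<open>t ^ (n - k)\<close>, which keeps its leading coefficient.\<close>
  have lead: "\<exists>z\<in>ideal_span (adjoin S t) Z. z - a * t ^ n \<in> polys_below S t n"
    if "k \<le> N" "k \<le> n" "a \<in> ideal_span S (G k)" for a k n
    using that(3)
  proof induction
    case zero
    then show ?case by (intro bexI[of _ 0]) (auto intro: ideal_span.zero S.zero_polys_below)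
  next
    case (step c x a)
    then obtain z where z: "z \<in> ideal_span (adjoin S t) Z" "z - a * t ^ n \<in> polys_below S t n"
      by blast
    define w where "w = x * t ^ k + \<phi> k x"
    have "w \<in> Z" unfolding w_def Z_def using step that(1) by auto
    moreover have "c * t ^ (n - k) \<in> adjoin S t"
      using step S.subset_adjoin[of t] by (intro T.mult_mem t_pow) auto
    ultimately have 1: "(c * t ^ (n - k)) * w + z \<in> ideal_span (adjoin S t) Z"
      using z by (intro ideal_span.step)
    have "x \<in> L k" using step G by blast
    then have "t ^ (n - k) * \<phi> k x \<in> polys_below S t n"
      using S.polys_below_shift[of "\<phi> k x" t k "n - k"] \<phi> that by simp
    then have "c * (t ^ (n - k) * \<phi> k x) + (z - a * t ^ n) \<in> polys_below S t n"
      using step.hyps z by (intro S.polys_below_add[OF S.polys_below_scale]) auto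
    also have "c * (t ^ (n - k) * \<phi> k x) + (z - a * t ^ n)
        = (c * t ^ (n - k)) * w + z - (c * x + a) * t ^ n"
    proof -
      have "t ^ n = t ^ (n - k) * t ^ k" using that by (simp flip: power_add)
      then show ?thesis unfolding w_def by (simp add: algebra_simps)
    qed
    finally show ?case using 1 by blast
  qed
  \<comment> \<open>Cancelling the leading term with an element of the span of \<open>Z\<close>
    lowers the level by one.\<close>
  have main: "h \<in> I \<Longrightarrow> h \<in> polys_below S t n \<Longrightarrow> h \<in> ideal_span (adjoin S t) Z" for h n
  proof (induction n arbitrary: h)
    case 0
    then show ?case by (simp add: ideal_span.zero)
  next
    case (Suc n)
    then obtain a p where h: "h = a * t ^ n + p" "a \<in> S" "p \<in> polys_below S t n" by auto
    then have "a \<in> L n" unfolding L_def using Suc by auto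
    then have "a \<in> ideal_span S (G (min n N))" using G(3) L_min by blast
    then obtain z where z: "z \<in> ideal_span (adjoin S t) Z" "z - a * t ^ n \<in> polys_below S t n"
      using lead[of "min n N" n a] by auto
    have "p - (z - a * t ^ n) \<in> polys_below S t n" using h z S.polys_below_diff by blast
    then have hz: "h - z \<in> polys_below S t n" by (simp add: h algebra_simps)
    have "z \<in> I" using z T.span_subset[of Z X] Z_I unfolding I_def by blast
    then have "h - z \<in> ideal_span (adjoin S t) Z" using Suc hz I_add by blast
    then have "(h - z) + z \<in> ideal_span (adjoin S t) Z" using z T.span_add by blast
    then show ?case by simp
  qed
  have X_Z: "X \<subseteq> ideal_span (adjoin S t) Z"
  proof
    fix x assume x: "x \<in> X"
    then obtain n where "x \<in> polys_below S t n" using X unfolding adjoin_def by blast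
    moreover have "x \<in> I" unfolding I_def using x by (rule T.span_base)
    ultimately show "x \<in> ideal_span (adjoin S t) Z" using main by blast
  qed
  \<comment> \<open>\<open>Z\<close> lies in the ideal but perhaps not in \<open>X\<close>; each of
    its finitely many elements involves only finitely many members of \<open>X\<close>.\<close>
  have "\<forall>z. \<exists>W. z \<in> Z \<longrightarrow> W \<subseteq> X \<and> finite W \<and> z \<in> ideal_span (adjoin S t) W"
    using Z_I unfolding I_def by (meson ideal_span_finite_support subsetD)
  then obtain W where W: "\<And>z. z \<in> Z \<Longrightarrow> W z \<subseteq> X \<and> finite (W z) \<and> z \<in> ideal_span (adjoin S t) (W z)"
    by metis
  define Y' where "Y' = (\<Union>z\<in>Z. W z)"
  have "Z \<subseteq> ideal_span (adjoin S t) Y'"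
  proof
    fix z assume "z \<in> Z"
    then show "z \<in> ideal_span (adjoin S t) Y'"
      using W[of z] ideal_span_mono[of "adjoin S t" _ "W z" Y'] unfolding Y'_def by blast
  qed
  then have "X \<subseteq> ideal_span (adjoin S t) Y'" using X_Z T.span_subset by blast
  moreover have "finite Y'" "Y' \<subseteq> X" unfolding Y'_def using W \<open>finite Z\<close> by auto
  ultimately show "\<exists>Y\<subseteq>X. finite Y \<and> X \<subseteq> ideal_span (adjoin S t) Y" by blast
qed

subsection \<open>Algebras of complex-valued functions\<close>

text \<open>Fraction-free Gaussian elimination: coordinate \<open>i\<close> is cleared by
  cross-multiplication with a pivot, without division, so the result also applies to vectors over
  \<open>complex poly\<close>.\<close>

lemma dependent_vectors:
  fixes v :: "'t \<Rightarrow> 'i \<Rightarrow> 'a::idom"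
  assumes "finite I" "finite T" "card I < card T"
  shows "\<exists>c. (\<exists>t\<in>T. c t \<noteq> 0) \<and> (\<forall>i\<in>I. (\<Sum>t\<in>T. c t * v t i) = 0)"
  using assms
proof (induction I arbitrary: T v rule: finite_induct)
  case empty
  then obtain t where "t \<in> T" by (metis card.empty equals0I less_irrefl)
  then show ?case by (intro exI[of _ "\<lambda>_. 1"]) auto
next
  case (insert i I)
  show ?case
  proof (cases "\<forall>t\<in>T. v t i = 0")
    case True
    have "card I < card T" using insert by simp
    then obtain c where "\<exists>t\<in>T. c t \<noteq> 0" "\<forall>j\<in>I. (\<Sum>t\<in>T. c t * v t j) = 0"
      using insert.IH[of T v] insert.prems by blast
    then show ?thesis using True by (intro exI[of _ c]) auto
  next
    case False
    then obtain s where s: "s \<in> T" "v s i \<noteq> 0" by blast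
    define w where "w t j = v s i * v t j - v t i * v s j" for t j
    have "card I < card (T - {s})" using insert s by simp
    then obtain c where c: "\<exists>t\<in>T-{s}. c t \<noteq> 0" "\<forall>j\<in>I. (\<Sum>t\<in>T-{s}. c t * w t j) = 0"
      using insert.IH[of "T - {s}" w] insert.prems by blast
    define d where "d t = (if t = s then - (\<Sum>t\<in>T-{s}. c t * v t i) else c t * v s i)" for t
    have d: "(\<Sum>t\<in>T. d t * v t j) = (\<Sum>t\<in>T-{s}. c t * w t j)" for j
    proof -
      have "(\<Sum>t\<in>T. d t * v t j) = d s * v s j + (\<Sum>t\<in>T-{s}. d t * v t j)"
        using insert.prems s by (simp add: sum.remove)
      also have "(\<Sum>t\<in>T-{s}. d t * v t j) = (\<Sum>t\<in>T-{s}. c t * v s i * v t j)"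
        by (intro sum.cong) (auto simp: d_def)
      also have "d s * v s j = (\<Sum>t\<in>T-{s}. - (c t * v t i * v s j))"
        by (simp add: d_def sum_distrib_right sum_negf)
      also have "\<dots> + (\<Sum>t\<in>T-{s}. c t * v s i * v t j) = (\<Sum>t\<in>T-{s}. c t * w t j)"
        by (simp add: w_def algebra_simps sum_subtractf sum_negf)
      finally show ?thesis .
    qed
    have "(\<Sum>t\<in>T. d t * v t j) = 0" if "j \<in> insert i I" for j
    proof (cases "j = i")
      case True
      then show ?thesis unfolding d by (simp add: w_def mult.commute)
    next
      case False
      then show ?thesis unfolding d using c(2) that by simp
    qed
    moreover have "\<exists>t\<in>T. d t \<noteq> 0" using c(1) s by (auto simp: d_def)
    ultimately show ?thesis by blast
  qed
qed

text \<open>With these as the coefficient ring, \<open>ideal_span\<close> becomes the complex linear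
  span, and the lemmas on ideals serve for vector spaces too.\<close>

definition constants :: "('x \<Rightarrow> complex) set" where
  "constants = range (\<lambda>c x. c)"

lemma const_in_constants [simp]: "(\<lambda>_. c) \<in> constants"
  by (simp add: constants_def)

lemma subring_constants: "subring_set constants"
proof
  show "1 \<in> constants" unfolding constants_def one_fun_def by blast
  fix a b :: "'a \<Rightarrow> complex"
  assume "a \<in> constants" "b \<in> constants"
  then show "a - b \<in> constants" "a * b \<in> constants"
    by (auto simp: constants_def fun_diff_def times_fun_def)
qed

interpretation constants: subring_set constants
  by (rule subring_constants)

abbreviation lin_span :: "('x \<Rightarrow> complex) set \<Rightarrow> ('x \<Rightarrow> complex) set" where
  "lin_span \<equiv> ideal_span constants"

lemma lin_span_scale: "f \<in> lin_span M \<Longrightarrow> (\<lambda>_. c) * f \<in> lin_span M"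
  by (intro constants.span_mult) simp

lemma sum_fun_apply: "sum f I x = (\<Sum>i\<in>I. f i x)"
  by (induction I rule: infinite_finite_induct) auto

lemma lin_span_finite_iff:
  assumes "finite Y"
  shows "f \<in> lin_span Y \<longleftrightarrow> (\<exists>c. f = (\<Sum>y\<in>Y. (\<lambda>_. c y) * y))"
proof
  assume "f \<in> lin_span Y"
  then obtain h where h: "\<forall>y\<in>Y. h y \<in> constants" "f = (\<Sum>y\<in>Y. h y * y)"
    unfolding constants.span_finite_iff[OF assms] by blast
  then have "\<forall>y\<in>Y. \<exists>c. h y = (\<lambda>_. c)" unfolding constants_def by blast
  then obtain c where "\<And>y. y \<in> Y \<Longrightarrow> h y = (\<lambda>_. c y)" by metis
  then have "f = (\<Sum>y\<in>Y. (\<lambda>_. c y) * y)" unfolding h(2) by (intro sum.cong) auto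
  then show "\<exists>c. f = (\<Sum>y\<in>Y. (\<lambda>_. c y) * y)" by blast
next
  assume "\<exists>c. f = (\<Sum>y\<in>Y. (\<lambda>_. c y) * y)"
  then show "f \<in> lin_span Y"
    by (auto intro!: constants.span_sum constants.span_mult_base)
qed

text \<open>Finitely many points \<open>P\<close> give coordinates on a finite-dimensional function
  space, with dual basis \<open>e\<close>. A new generator either is already interpolated by
  \<open>P\<close>, or its remainder is nonzero at some point, and that point is added.\<close>

lemma interpolation_basis:
  fixes M :: "('x \<Rightarrow> complex) set"
  assumes "finite M"
  shows "\<exists>P e. finite P \<and> (\<forall>p\<in>P. e p \<in> lin_span M) \<and>
    (\<forall>p\<in>P. \<forall>q\<in>P. e p q = (if p = q then 1 else 0)) \<and>
    (\<forall>f\<in>lin_span M. \<forall>x. f x = (\<Sum>p\<in>P. f p * e p x))"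
  using assms
proof (induction M rule: finite_induct)
  case empty
  have "f = 0" if "f \<in> lin_span {}" for f :: "'x \<Rightarrow> complex"
    using that by cases auto
  then have "\<forall>f\<in>lin_span {}. \<forall>x::'x. f x = 0" by (metis zero_fun_apply)
  then show ?case by (intro exI[of _ "{}"]) auto
next
  case (insert m M)
  then obtain P e where P: "finite P" "\<forall>p\<in>P. e p \<in> lin_span M"
    "\<forall>p\<in>P. \<forall>q\<in>P. e p q = (if p = q then 1 else 0)"
    "\<forall>f\<in>lin_span M. \<forall>x. f x = (\<Sum>p\<in>P. f p * e p x)" by blast
  have sub: "lin_span M \<subseteq> lin_span (insert m M)" by (rule ideal_span_mono) auto
  define m' where "m' = m - (\<Sum>p\<in>P. (\<lambda>_. m p) * e p)"
  have sum_span: "(\<Sum>p\<in>P. (\<lambda>_. c p) * e p) \<in> lin_span M" for c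
    using P by (intro constants.span_sum lin_span_scale) auto
  have m'_span: "m' \<in> lin_span (insert m M)" unfolding m'_def
    by (rule constants.span_diff[OF constants.span_base subsetD[OF sub sum_span]]) simp
  have m'_x: "m' x = m x - (\<Sum>p\<in>P. m p * e p x)" for x
    by (simp add: m'_def sum_fun_apply)
  have m'_P: "m' p = 0" if "p \<in> P" for p
  proof -
    have "(\<Sum>q\<in>P. m q * e q p) = (\<Sum>q\<in>P. if q = p then m q else 0)"
      using P that by (intro sum.cong) auto
    then show ?thesis using that P by (simp add: m'_x)
  qed
  have decomp: "\<exists>c. f - (\<lambda>_. c) * m \<in> lin_span M" if "f \<in> lin_span (insert m M)" for f
    using constants.span_insert[OF that] unfolding constants_def by blast
  show ?case
  proof (cases "m' = 0")
    case True
    have "lin_span (insert m M) \<subseteq> lin_span M"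
    proof (rule constants.span_subset)
      have "m = (\<Sum>p\<in>P. (\<lambda>_. m p) * e p)" using True unfolding m'_def by simp
      then have "m \<in> lin_span M" using sum_span[of m] by simp
      then show "insert m M \<subseteq> lin_span M" using constants.span_base by blast
    qed
    then show ?thesis using P sub by (intro exI[of _ P] exI[of _ e]) blast
  next
    case False
    then obtain z where z: "m' z \<noteq> 0" by (auto simp: fun_eq_iff)
    then have zP: "z \<notin> P" using m'_P by blast
    define n where "n = (\<lambda>_. inverse (m' z)) * m'"
    \<comment> \<open>The old basis functions are corrected to vanish at the new point
      \<open>z\<close>; their values on \<open>P\<close> are unaffected because \<open>n\<close>
      vanishes there.\<close>
    define e' where "e' p = (if p = z then n else e p - (\<lambda>_. e p z) * n)" for p
    have n_span: "n \<in> lin_span (insert m M)"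
      unfolding n_def by (intro lin_span_scale m'_span)
    have nz: "n z = 1" "\<And>p. p \<in> P \<Longrightarrow> n p = 0" using z m'_P by (auto simp: n_def)
    have "e' p \<in> lin_span (insert m M)" if "p \<in> insert z P" for p
      unfolding e'_def using that P sub n_span
      by (auto intro!: constants.span_diff lin_span_scale)
    moreover have "e' p q = (if p = q then 1 else 0)" if "p \<in> insert z P" "q \<in> insert z P" for p q
      using that P(3) nz zP by (auto simp: e'_def)
    moreover have "f x = (\<Sum>p\<in>insert z P. f p * e' p x)" if "f \<in> lin_span (insert m M)" for f x
    proof -
      obtain c where c: "f - (\<lambda>_. c) * m \<in> lin_span M" using decomp \<open>f \<in> _\<close> by blast
      define g where "g = f - (\<lambda>_. c) * m'"
      have "g = (f - (\<lambda>_. c) * m) + (\<Sum>p\<in>P. (\<lambda>_. c * m p) * e p)"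
        by (auto simp: g_def m'_def fun_eq_iff sum_fun_apply algebra_simps sum_distrib_left)
      then have "g \<in> lin_span M" using c sum_span by (auto intro: ideal_span_add)
      then have gx: "g x = (\<Sum>p\<in>P. g p * e p x)" for x using P(4) by blast
      have gP: "g p = f p" if "p \<in> P" for p using m'_P that by (simp add: g_def)
      have gx': "g x = (\<Sum>p\<in>P. f p * e p x)" for x
        unfolding gx[of x] by (intro sum.cong) (auto simp: gP)
      have fx: "f x = (\<Sum>p\<in>P. f p * e p x) + c * m' x" for x
        using gx'[of x] by (simp add: g_def algebra_simps)
      have m'n: "c * m' x = (c * m' z) * n x" using z by (simp add: n_def)
      have "(\<Sum>p\<in>insert z P. f p * e' p x) = f z * n x + (\<Sum>p\<in>P. f p * e' p x)"
        using P zP by (simp add: e'_def)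
      also have "(\<Sum>p\<in>P. f p * e' p x) = (\<Sum>p\<in>P. f p * e p x - (f p * e p z) * n x)"
        using zP by (intro sum.cong) (auto simp: e'_def algebra_simps)
      also have "\<dots> = (\<Sum>p\<in>P. f p * e p x) - (\<Sum>p\<in>P. f p * e p z) * n x"
        by (simp add: sum_subtractf sum_distrib_right)
      also have "(\<Sum>p\<in>P. f p * e p z) = f z - c * m' z" using fx[of z] by simp
      finally have "(\<Sum>p\<in>insert z P. f p * e' p x) = (\<Sum>p\<in>P. f p * e p x) + (c * m' z) * n x"
        by (simp add: algebra_simps)
      then show ?thesis unfolding m'n[symmetric] fx[symmetric] by simp
    qed
    ultimately show ?thesis using P(1) by (intro exI[of _ "insert z P"] exI[of _ e']) blast
  qed
qed

section \<open>Function algebras and Noetherianity of finitely generated ones\<close>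

locale function_algebra =
  fixes S :: "('x \<Rightarrow> complex) set"
  assumes const_mem: "(\<lambda>_. c) \<in> S"
    and add_mem': "a \<in> S \<Longrightarrow> b \<in> S \<Longrightarrow> a + b \<in> S"
    and mult_mem': "a \<in> S \<Longrightarrow> b \<in> S \<Longrightarrow> a * b \<in> S"
begin

sublocale subring_set S
proof
  show "1 \<in> S" unfolding one_fun_def by (rule const_mem)
  fix a b assume "a \<in> S" "b \<in> S"
  then have "a + (\<lambda>_. - 1) * b \<in> S" by (intro add_mem' mult_mem' const_mem)
  moreover have "a - b = a + (\<lambda>_. - 1) * b" by (simp add: fun_eq_iff)
  ultimately show "a - b \<in> S" by metis
qed (rule mult_mem')

lemma lin_span_subset_span: "lin_span X \<subseteq> ideal_span S X"
  by (rule ideal_span_mono) (auto simp: constants_def const_mem)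

lemma poly_mem: "t \<in> S \<Longrightarrow> (\<lambda>x. poly h (t x)) \<in> S"
proof (induction h)
  case 0
  then show ?case using const_mem[of 0] by simp
next
  case (pCons a h)
  have "(\<lambda>x. poly (pCons a h) (t x)) = (\<lambda>_. a) + t * (\<lambda>x. poly h (t x))" by auto
  then show ?case using pCons by (auto intro: add_mem mult_mem const_mem)
qed

end

lemma function_algebra_generated: "function_algebra (generated_algebra T)"
  by standard (auto simp: plus_fun_def times_fun_def intro: generated_algebra.intros)

lemma generated_algebra_least:
  assumes "function_algebra A" "T \<subseteq> A"
  shows "generated_algebra T \<subseteq> A"
proof
  interpret function_algebra A by fact
  fix f assume "f \<in> generated_algebra T"
  then show "f \<in> A"
  proof induction
    case (add f h)
    then show ?case using add_mem[of f h] by (simp add: plus_fun_def)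
  next
    case (mult f h)
    then show ?case using mult_mem[of f h] by (simp add: times_fun_def)
  qed (use assms const_mem in auto)
qed

lemma noetherian_constants: "noetherian (constants :: ('x \<Rightarrow> complex) set)"
  unfolding noetherian_def
proof (intro allI impI)
  fix X :: "('x \<Rightarrow> complex) set" assume X: "X \<subseteq> constants"
  show "\<exists>Y\<subseteq>X. finite Y \<and> X \<subseteq> lin_span Y"
  proof (cases "X \<subseteq> {0}")
    case True
    then show ?thesis by (intro exI[of _ "{}"]) (auto intro: ideal_span.zero)
  next
    case False
    then obtain a where a: "a \<in> X" "a \<noteq> 0" by blast
    then obtain c where c: "a = (\<lambda>_. c)" "c \<noteq> 0" using X by (auto simp: constants_def zero_fun_def)
    have "x \<in> lin_span {a}" if "x \<in> X" for x
    proof -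
      have "x \<in> constants" using X that by blast
      then obtain d where "x = (\<lambda>_. d)" unfolding constants_def by (elim rangeE)
      then have "x = (\<lambda>_. d / c) * a" using c by auto
      moreover have "(\<lambda>_. d / c) * a \<in> lin_span {a}"
        by (intro lin_span_scale constants.span_base) simp
      ultimately show ?thesis by metis
    qed
    then show ?thesis using a by (intro exI[of _ "{a}"]) auto
  qed
qed

lemma noetherian_generated_algebra:
  assumes "finite T"
  shows "noetherian (generated_algebra T)"
  using assms
proof (induction T rule: finite_induct)
  case empty
  have "function_algebra constants"
    by standard (auto intro: constants.add_mem constants.mult_mem)
  then have "generated_algebra {} \<subseteq> constants" by (rule generated_algebra_least) simp
  then have "generated_algebra {} = (constants :: ('a \<Rightarrow> complex) set)"
    by (auto simp: constants_def intro: generated_algebra.const)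
  then show ?case by (simp add: noetherian_constants)
next
  case (insert t T)
  interpret T: function_algebra "generated_algebra T" by (rule function_algebra_generated)
  interpret T': function_algebra "generated_algebra (insert t T)"
    by (rule function_algebra_generated)
  interpret A: subring_set "adjoin (generated_algebra T) t" by (rule T.subring_adjoin)
  have "function_algebra (adjoin (generated_algebra T) t)"
    using T.subset_adjoin[of t] T.const_mem
    by unfold_locales (auto intro: A.add_mem A.mult_mem)
  then have 1: "generated_algebra (insert t T) \<subseteq> adjoin (generated_algebra T) t"
    using T.subset_adjoin[of t] T.gen_adjoin[of t]
    by (intro generated_algebra_least) (auto intro: generated_algebra.gen)
  have sub: "generated_algebra T \<subseteq> generated_algebra (insert t T)"
    by (rule generated_algebra_least[OF function_algebra_generated]) (auto intro: generated_algebra.gen)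
  have t: "t \<in> generated_algebra (insert t T)" by (auto intro: generated_algebra.gen)
  have "polys_below (generated_algebra T) t n \<subseteq> generated_algebra (insert t T)" for n
    by (induction n) (use sub t in \<open>auto intro!: T'.add_mem T'.mult_mem T'.power_mem T'.zero_mem\<close>)
  then have "adjoin (generated_algebra T) t \<subseteq> generated_algebra (insert t T)"
    unfolding adjoin_def by blast
  then show ?case
    using 1 hilbert_basis[OF T.subring_set_axioms insert.IH, of t] by simp
qed

section \<open>Degree filtration of a generated algebra\<close>

inductive degree_le :: "('x \<Rightarrow> complex) set \<Rightarrow> nat \<Rightarrow> ('x \<Rightarrow> complex) \<Rightarrow> bool" for D where
  const: "degree_le D d (\<lambda>_. c)"
| add: "degree_le D d f \<Longrightarrow> degree_le D d g \<Longrightarrow> degree_le D d (f + g)"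
| mult: "t \<in> D \<Longrightarrow> degree_le D d f \<Longrightarrow> degree_le D (Suc d) (t * f)"
| Suc: "degree_le D d f \<Longrightarrow> degree_le D (Suc d) f"

lemma degree_le_mono: "d \<le> e \<Longrightarrow> degree_le D d f \<Longrightarrow> degree_le D e f"
  by (induction rule: dec_induct) (auto intro: degree_le.Suc)

lemma degree_le_scale: "degree_le D d f \<Longrightarrow> degree_le D d ((\<lambda>_. c) * f)"
proof (induction rule: degree_le.induct)
  case (const d b)
  then show ?case using degree_le.const[of D d "c * b"] by (simp add: times_fun_def)
next
  case (add d f g)
  show "degree_le D d ((\<lambda>_. c) * (f + g))"
    unfolding distrib_left by (rule degree_le.add) fact+
next
  case (mult t d f)
  show "degree_le D (Suc d) ((\<lambda>_. c) * (t * f))"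
    unfolding mult.left_commute[of _ t] by (rule degree_le.mult) fact+
next
  case (Suc d f)
  then show ?case by (simp add: degree_le.Suc)
qed

lemma degree_le_mult:
  assumes "degree_le D d f" "degree_le D e g"
  shows "degree_le D (d + e) (f * g)"
  using assms
proof (induction rule: degree_le.induct)
  case (const d c)
  then show ?case by (intro degree_le_mono[OF _ degree_le_scale]) auto
next
  case (add d f f')
  show "degree_le D (d + e) ((f + f') * g)"
    unfolding distrib_right by (rule degree_le.add) (use add in blast)+
next
  case (mult t d f)
  show "degree_le D (Suc d + e) (t * f * g)"
    unfolding mult.assoc add_Suc by (rule degree_le.mult) (use mult in blast)+
next
  case (Suc d f)
  then show ?case by (simp add: degree_le.Suc)
qed

lemma degree_le_exists: "f \<in> generated_algebra D \<Longrightarrow> \<exists>d. degree_le D d f"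
proof (induction rule: generated_algebra.induct)
  case (gen f)
  then have "degree_le D (Suc 0) (f * (\<lambda>_. 1))" by (intro degree_le.intros)
  then show ?case by (auto simp: times_fun_def)
next
  case (const c)
  then show ?case by (auto intro: degree_le.const)
next
  case (add f h)
  then obtain d e where "degree_le D d f" "degree_le D e h" by blast
  then have "degree_le D (max d e) (f + h)"
    by (intro degree_le.add) (auto intro: degree_le_mono[rotated])
  then show ?case by (auto simp: plus_fun_def)
next
  case (mult f h)
  then obtain d e where "degree_le D d f" "degree_le D e h" by blast
  then have "degree_le D (d + e) (f * h)" by (rule degree_le_mult)
  then show ?case by (auto simp: times_fun_def)
qed

lemma degree_le_generated: "degree_le D d f \<Longrightarrow> f \<in> generated_algebra D"
proof -
  interpret function_algebra "generated_algebra D" by (rule function_algebra_generated)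
  show "degree_le D d f \<Longrightarrow> f \<in> generated_algebra D"
    by (induction rule: degree_le.induct)
      (assumption | rule add_mem mult_mem const_mem generated_algebra.gen)+
qed

text \<open>\<open>D\<close> may be infinite, as the dual space is, while \<open>T\<close> is a
  finite spanning subset: expanding each factor in \<open>T\<close> shows that the products of at
  most \<open>d\<close> elements of \<open>T\<close>, collected in \<open>M d\<close>, span
  everything of degree at most \<open>d\<close>.\<close>

lemma degree_le_finite_dim:
  assumes "finite T" "T \<subseteq> D" "D \<subseteq> lin_span T"
  shows "\<exists>M. finite M \<and> {f. degree_le D d f} = lin_span M"
proof -
  define M where "M n = ((\<lambda>M. M \<union> (\<lambda>(t, m). t * m) ` (T \<times> M)) ^^ n) {\<lambda>_. 1}" for n
  have M_Suc: "M (Suc n) = M n \<union> (\<lambda>(t, m). t * m) ` (T \<times> M n)" for n by (simp add: M_def)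
  have fin: "finite (M n)" for n using assms(1) by (induction n) (auto simp: M_Suc, simp add: M_def)
  have one: "(\<lambda>_. 1) \<in> M n" for n by (induction n) (auto simp: M_Suc, simp add: M_def)
  have "f \<in> lin_span (M d)" if "degree_le D d f" for f d
    using that
  proof induction
    case (const d c)
    have "(\<lambda>_. c) = (\<lambda>_. c) * (\<lambda>_. 1)" by (simp add: times_fun_def)
    then show ?case using one by (metis constants.span_base lin_span_scale)
  next
    case (add d f g)
    show ?case by (rule ideal_span_add) fact+
  next
    case (mult t d f)
    have tm: "u * f \<in> lin_span (M (Suc d))" if "u \<in> T" for u
      using \<open>f \<in> lin_span (M d)\<close>
    proof induction
      case zero
      show "u * 0 \<in> lin_span (M (Suc d))" unfolding mult_zero_right by (rule ideal_span.zero)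
    next
      case (step c m f)
      have "u * m \<in> lin_span (M (Suc d))"
        using step that by (intro constants.span_base) (auto simp: M_Suc)
      then have "c * (u * m) + u * f \<in> lin_span (M (Suc d))"
        using step by (intro ideal_span_add[OF constants.span_mult])
      then show "u * (c * m + f) \<in> lin_span (M (Suc d))"
        unfolding distrib_left mult.left_commute[of c] .
    qed
    have "t \<in> lin_span T" using mult assms by blast
    then show "t * f \<in> lin_span (M (Suc d))"
    proof induction
      case zero
      show "0 * f \<in> lin_span (M (Suc d))" unfolding mult_zero_left by (rule ideal_span.zero)
    next
      case (step c u g)
      have "c * (u * f) + g * f \<in> lin_span (M (Suc d))"
        by (rule ideal_span_add[OF constants.span_mult[OF step(1) tm[OF step(2)]] step.IH])
      then show "(c * u + g) * f \<in> lin_span (M (Suc d))" unfolding distrib_right mult.assoc .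
    qed
  next
    case (Suc d f)
    then show ?case using ideal_span_mono[of constants constants "M d" "M (Suc d)"]
      by (auto simp: M_Suc)
  qed
  moreover have "degree_le D d f" if "f \<in> lin_span (M d)" for f d
  proof -
    have M: "m \<in> M d \<Longrightarrow> degree_le D d m" for m d
      by (induction d arbitrary: m)
        (use assms(2) in \<open>auto simp: M_Suc intro: degree_le.mult degree_le.Suc\<close>,
          simp add: M_def degree_le.const)
    show ?thesis using that
    proof induction
      case zero
      show ?case unfolding zero_fun_def by (rule degree_le.const)
    next
      case (step c m f)
      then obtain a where "c = (\<lambda>_. a)" unfolding constants_def by (elim rangeE)
      then show ?case by (simp only: degree_le.add[OF degree_le_scale[OF M[OF step(2)]] step.IH])
    qed
  qed
  ultimately have "{f. degree_le D d f} = lin_span (M d)" by blast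
  then show ?thesis using fin by blast
qed

subsection \<open>The Nullstellensatz\<close>

text \<open>Pigeonhole: a countable union of finite sets is countable, and the complex numbers are
  not.\<close>

lemma infinite_fibre_nat:
  fixes h :: "complex \<Rightarrow> nat"
  shows "\<exists>n. infinite {c. h c = n}"
proof (rule ccontr)
  assume "\<nexists>n. infinite {c. h c = n}"
  then have "countable (\<Union>n. {c. h c = n})"
    by (intro countable_UN) (auto intro: countable_finite)
  moreover have "(\<Union>n. {c. h c = n}) = UNIV" by auto
  ultimately show False using uncountable_UNIV_complex by simp
qed

context function_algebra
begin

text \<open>
  Over an uncountable field, an element of a countably generated algebra can be specialised to
  a constant: the relations saying that every specialisation fails satisfy a linear dependence,
  which produces a polynomial equation for the element.
\<close>

lemma specialise_element:
  fixes M :: "nat \<Rightarrow> ('x \<Rightarrow> complex) set"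
  assumes X: "X \<subseteq> S" and f: "f \<in> S" and t: "t \<in> S"
    and W: "\<And>d. finite (M d)" "S \<subseteq> (\<Union>d. lin_span (M d))"
    and nf: "\<And>n. f ^ n \<notin> ideal_span S X"
  shows "\<exists>c. \<forall>n. f ^ n \<notin> ideal_span S (insert (t - (\<lambda>_. c)) X)"
proof (rule ccontr)
  assume "\<not> ?thesis"
  then have "\<forall>c. \<exists>n. f ^ n \<in> ideal_span S (insert (t - (\<lambda>_. c)) X)" by blast
  then have "\<forall>c. \<exists>n q d. q \<in> S \<and> q \<in> lin_span (M d) \<and> f ^ n - q * (t - (\<lambda>_. c)) \<in> ideal_span S X"
    using span_insert W(2) by blast
  then obtain n q d where q: "\<And>c. q c \<in> S" "\<And>c. q c \<in> lin_span (M (d c))"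
    "\<And>c. f ^ n c - q c * (t - (\<lambda>_. c)) \<in> ideal_span S X"
    by metis
  \<comment> \<open>A linear factor \<open>t - r\<close> of \<open>h(t)\<close> is traded for a
    further power of \<open>f\<close> by means of \<open>q r\<close>; after all factors are gone, a
    power of \<open>f\<close> itself lies in the ideal, against \<open>nf\<close>.\<close>
  have no_root: False if "h \<noteq> 0" "f ^ N * (\<lambda>x. poly h (t x)) \<in> ideal_span S X" for h N
    using that
  proof (induction "degree h" arbitrary: h N)
    case 0
    then obtain a where a: "h = [:a:]" "a \<noteq> 0" by (metis degree_eq_zeroE pCons_0_0)
    have "(\<lambda>_. inverse a) * (f ^ N * (\<lambda>x. poly h (t x))) \<in> ideal_span S X"
      by (rule span_mult[OF const_mem 0(3)])
    moreover have "(\<lambda>_. inverse a) * (f ^ N * (\<lambda>x. poly h (t x))) = f ^ N"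
      using a by (simp add: fun_eq_iff)
    ultimately show ?case using nf by simp
  next
    case (Suc m)
    then have "\<not> constant (poly h)" by (simp add: constant_degree)
    then obtain r where "poly h r = 0" using fundamental_theorem_of_algebra by blast
    then obtain k where k: "h = [:-r, 1:] * k" by (meson dvdE poly_eq_0_iff_dvd)
    with Suc.prems have "k \<noteq> 0" by auto
    then have "degree h = degree [:-r, 1:] + degree k" unfolding k by (intro degree_mult_eq) auto
    then have deg: "m = degree k" using Suc.hyps(2) by simp
    define K where "K = (\<lambda>x. poly k (t x))"
    have KS: "K \<in> S" unfolding K_def by (rule poly_mem[OF t])
    have hK: "(\<lambda>x. poly h (t x)) = (t - (\<lambda>_. r)) * K"
      by (simp add: fun_eq_iff k K_def algebra_simps)
    have 1: "q r * (f ^ N * ((t - (\<lambda>_. r)) * K)) \<in> ideal_span S X"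
      by (rule span_mult[OF q(1) Suc.prems(2)[unfolded hK]])
    have 2: "f ^ N * K * (f ^ n r - q r * (t - (\<lambda>_. r))) \<in> ideal_span S X"
      by (intro span_mult mult_mem power_mem f KS q)
    have "f ^ (N + n r) * K = q r * (f ^ N * ((t - (\<lambda>_. r)) * K))
        + f ^ N * K * (f ^ n r - q r * (t - (\<lambda>_. r)))"
      by (simp add: algebra_simps power_add)
    then have "f ^ (N + n r) * K \<in> ideal_span S X" using span_add[OF 1 2] by simp
    then show False using Suc.hyps(1)[OF deg \<open>k \<noteq> 0\<close>] unfolding K_def by blast
  qed
  \<comment> \<open>Infinitely many constants share both the exponent of \<open>f\<close> and the
    finite-dimensional space that contains the multiplier \<open>q c\<close>.\<close>
  obtain p where "infinite {c. prod_encode (n c, d c) = p}"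
    using infinite_fibre_nat[of "\<lambda>c. prod_encode (n c, d c)"] by blast
  moreover obtain n0 d0 where "p = prod_encode (n0, d0)" by (metis prod_decode_inverse surj_pair)
  ultimately have inf: "infinite {c. n c = n0 \<and> d c = d0}" by (simp add: prod_encode_eq)
  obtain P e where P: "finite P" "\<forall>f\<in>lin_span (M d0). \<forall>x. f x = (\<Sum>p\<in>P. f p * e p x)"
    using interpolation_basis[OF W(1)[of d0]] by blast
  obtain C where C: "C \<subseteq> {c. n c = n0 \<and> d c = d0}" "finite C" "card C = Suc (card P)"
    using infinite_arbitrarily_large[OF inf] by blast
  obtain l where l: "\<exists>c\<in>C. l c \<noteq> 0" "\<forall>p\<in>P. (\<Sum>c\<in>C. l c * q c p) = 0"
    using dependent_vectors[of P C "\<lambda>c p. q c p"] P C by auto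
  have lq: "(\<Sum>c\<in>C. l c * q c x) = 0" for x
  proof -
    have "(\<Sum>c\<in>C. l c * q c x) = (\<Sum>c\<in>C. l c * (\<Sum>p\<in>P. q c p * e p x))"
      using P(2) q(2) C(1) by (intro sum.cong) auto
    also have "\<dots> = (\<Sum>p\<in>P. (\<Sum>c\<in>C. l c * q c p) * e p x)"
      by (simp add: sum_distrib_left sum_distrib_right sum.swap[of _ C P] mult.assoc)
    finally show ?thesis using l by simp
  qed
  \<comment> \<open>Each relation for \<open>c\<close> is multiplied by \<open>l c\<close> and by
    the product of all \<open>t - b\<close> with \<open>b\<close> different from \<open>c\<close>.
    The multipliers \<open>q c\<close> then all carry the full product over \<open>C\<close> and
    cancel by \<open>lq\<close>; what remains is \<open>f ^ n0\<close> times \<open>h(t)\<close>. As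
    in Lagrange interpolation, \<open>h\<close> is nonzero at any \<open>a\<close> with
    \<open>l a\<close> nonzero.\<close>
  define h where "h = (\<Sum>c\<in>C. smult (l c) (\<Prod>b\<in>C-{c}. [:-b, 1:]))"
  obtain a where a: "a \<in> C" "l a \<noteq> 0" using l by blast
  have "poly h a = (\<Sum>c\<in>C. if c = a then l a * (\<Prod>b\<in>C-{a}. a - b) else 0)"
    unfolding h_def poly_sum
    by (intro sum.cong) (use a C in \<open>auto simp: poly_prod\<close>)
  also have "\<dots> = l a * (\<Prod>b\<in>C-{a}. a - b)" using a C by simp
  also have "\<dots> \<noteq> 0" using a C by auto
  finally have "h \<noteq> 0" by auto
  have "(\<Sum>c\<in>C. ((\<lambda>_. l c) * (\<lambda>x. poly (\<Prod>b\<in>C-{c}. [:-b, 1:]) (t x))) *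
      (f ^ n c - q c * (t - (\<lambda>_. c)))) \<in> ideal_span S X"
    by (intro span_sum span_mult mult_mem const_mem poly_mem t q)
  also have "(\<Sum>c\<in>C. ((\<lambda>_. l c) * (\<lambda>x. poly (\<Prod>b\<in>C-{c}. [:-b, 1:]) (t x))) *
      (f ^ n c - q c * (t - (\<lambda>_. c)))) = f ^ n0 * (\<lambda>x. poly h (t x))"
  proof
    fix x
    have "(\<Sum>c\<in>C. ((\<lambda>_. l c) * (\<lambda>x. poly (\<Prod>b\<in>C-{c}. [:-b, 1:]) (t x))) *
      (f ^ n c - q c * (t - (\<lambda>_. c)))) x
      = (\<Sum>c\<in>C. l c * (\<Prod>b\<in>C-{c}. t x - b) * ((f ^ n0) x - q c x * (t x - c)))"
      unfolding sum_fun_apply by (intro sum.cong) (use C in \<open>auto simp: poly_prod\<close>)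
    also have "\<dots> = (\<Sum>c\<in>C. (f ^ n0) x * (l c * (\<Prod>b\<in>C-{c}. t x - b))
        - (\<Prod>b\<in>C. t x - b) * (l c * q c x))"
    proof (intro sum.cong refl)
      fix c assume "c \<in> C"
      then have prod: "(\<Prod>b\<in>C. t x - b) = (t x - c) * (\<Prod>b\<in>C-{c}. t x - b)"
        using C by (simp add: prod.remove)
      show "l c * (\<Prod>b\<in>C-{c}. t x - b) * ((f ^ n0) x - q c x * (t x - c))
        = (f ^ n0) x * (l c * (\<Prod>b\<in>C-{c}. t x - b)) - (\<Prod>b\<in>C. t x - b) * (l c * q c x)"
        unfolding prod by (simp only: algebra_simps)
    qed
    also have "\<dots> = (f ^ n0) x * (\<Sum>c\<in>C. l c * (\<Prod>b\<in>C-{c}. t x - b))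
        - (\<Prod>b\<in>C. t x - b) * (\<Sum>c\<in>C. l c * q c x)"
      by (simp add: sum_subtractf sum_distrib_left)
    also have "\<dots> = (f ^ n0 * (\<lambda>x. poly h (t x))) x"
      by (simp add: lq h_def poly_sum poly_prod)
    finally show "(\<Sum>c\<in>C. ((\<lambda>_. l c) * (\<lambda>x. poly (\<Prod>b\<in>C-{c}. [:-b, 1:]) (t x))) *
      (f ^ n c - q c * (t - (\<lambda>_. c)))) x = (f ^ n0 * (\<lambda>x. poly h (t x))) x" .
  qed
  finally show False using no_root[OF \<open>h \<noteq> 0\<close>] by blast
qed

end

lemma generated_algebra_filtration:
  assumes "finite T"
  shows "\<exists>M. (\<forall>d. finite (M d)) \<and> generated_algebra T \<subseteq> (\<Union>d::nat. lin_span (M d))"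
proof -
  have "T \<subseteq> lin_span T" using constants.span_base by blast
  then have "\<forall>d. \<exists>M. finite M \<and> {f. degree_le T d f} \<subseteq> lin_span M"
    using degree_le_finite_dim[OF assms order.refl] by (metis order.refl)
  then obtain M where "\<And>d. finite (M d)" "\<And>d. {f. degree_le T d f} \<subseteq> lin_span (M d)"
    by metis
  moreover have "f \<in> (\<Union>d. lin_span (M d))" if "f \<in> generated_algebra T" for f
    using degree_le_exists[OF that] calculation(2) by blast
  ultimately show ?thesis by (intro exI[of _ M]) blast
qed

text \<open>The generators are specialised to constants one after the other while all powers of
  \<open>f\<close> stay outside the ideal. In the end every element is congruent to its value at one
  point, which exists by \<open>surj\<close>, and this point contradicts \<open>van\<close>.\<close>

theorem nullstellensatz:
  assumes "finite T" and surj: "\<And>c. \<exists>x. \<forall>t\<in>T. t x = c t"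
    and X: "X \<subseteq> generated_algebra T" and f: "f \<in> generated_algebra T"
    and van: "\<And>x. (\<And>p. p \<in> X \<Longrightarrow> p x = 0) \<Longrightarrow> f x = 0"
  shows "\<exists>n. f ^ n \<in> ideal_span (generated_algebra T) X"
proof (rule ccontr)
  define S where "S = generated_algebra T"
  interpret S: function_algebra S unfolding S_def by (rule function_algebra_generated)
  assume "\<not> ?thesis"
  then have nf: "\<forall>n. f ^ n \<notin> ideal_span S X" unfolding S_def by blast
  obtain M where M: "\<And>d. finite (M d)" "S \<subseteq> (\<Union>d::nat. lin_span (M d))"
    using generated_algebra_filtration[OF \<open>finite T\<close>] unfolding S_def by blast
  have fS: "f \<in> S" using f unfolding S_def .
  have TS: "T \<subseteq> S" unfolding S_def by (auto intro: generated_algebra.gen)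
  have "\<exists>c. \<forall>n. f ^ n \<notin> ideal_span S ((\<lambda>t. t - (\<lambda>_. c t)) ` U \<union> X)" if "U \<subseteq> T" for U
    using finite_subset[OF that \<open>finite T\<close>] that
  proof (induction U rule: finite_induct)
    case empty
    then show ?case using nf by simp
  next
    case (insert t U)
    then obtain c where c: "\<forall>n. f ^ n \<notin> ideal_span S ((\<lambda>t. t - (\<lambda>_. c t)) ` U \<union> X)" by blast
    have "(\<lambda>t. t - (\<lambda>_. c t)) ` U \<union> X \<subseteq> S"
      using X insert.prems TS unfolding S_def[symmetric] by (auto intro!: S.diff_mem S.const_mem)
    moreover have "t \<in> S" using insert.prems TS by blast
    ultimately obtain b where b:
      "\<forall>n. f ^ n \<notin> ideal_span S (insert (t - (\<lambda>_. b)) ((\<lambda>t. t - (\<lambda>_. c t)) ` U \<union> X))"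
      using S.specialise_element[OF _ fS _ M] c by blast
    have "(\<lambda>u. u - (\<lambda>_. (c(t := b)) u)) ` insert t U \<union> X
        = insert (t - (\<lambda>_. b)) ((\<lambda>t. t - (\<lambda>_. c t)) ` U \<union> X)"
      using insert.hyps by auto
    then show ?case using b by metis
  qed
  then obtain c where c: "\<And>n. f ^ n \<notin> ideal_span S ((\<lambda>t. t - (\<lambda>_. c t)) ` T \<union> X)" by blast
  define I where "I = ideal_span S ((\<lambda>t. t - (\<lambda>_. c t)) ` T \<union> X)"
  obtain x where x: "\<And>t. t \<in> T \<Longrightarrow> t x = c t" using surj by blast
  have ev: "p - (\<lambda>_. p x) \<in> I" if "p \<in> S" for p
    using that unfolding S_def
  proof induction
    case (gen t)
    then have "t - (\<lambda>_. c t) \<in> I" unfolding I_def by (intro S.span_base) auto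
    then show ?case unfolding x[OF gen] .
  next
    case (const b)
    have "(\<lambda>_. b) - (\<lambda>_. b) \<in> I" unfolding I_def diff_self by (rule ideal_span.zero)
    then show ?case .
  next
    case (add p r)
    have "(p - (\<lambda>_. p x)) + (r - (\<lambda>_. r x)) \<in> I"
      using add.IH unfolding I_def by (rule ideal_span_add)
    moreover have "(p - (\<lambda>_. p x)) + (r - (\<lambda>_. r x)) = (\<lambda>y. p y + r y) - (\<lambda>_. p x + r x)"
      by (simp add: fun_eq_iff)
    ultimately show ?case by metis
  next
    case (mult p r)
    have "p * (r - (\<lambda>_. r x)) + (\<lambda>_. r x) * (p - (\<lambda>_. p x)) \<in> I"
      using mult unfolding I_def S_def[symmetric]
      by (intro ideal_span_add[OF S.span_mult S.span_mult] S.const_mem)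
    moreover have "p * (r - (\<lambda>_. r x)) + (\<lambda>_. r x) * (p - (\<lambda>_. p x)) = (\<lambda>y. p y * r y) - (\<lambda>_. p x * r x)"
      by (simp add: fun_eq_iff algebra_simps)
    ultimately show ?case by metis
  qed
  \<comment> \<open>Exponent 0 in \<open>c\<close> says that \<open>I\<close> is proper, so a member
    of \<open>X\<close> cannot be congruent to a nonzero constant. Exponent 1 is then contradicted
    by \<open>f x = 0\<close>.\<close>
  have "p x = 0" if "p \<in> X" for p
  proof (rule ccontr)
    assume nz: "p x \<noteq> 0"
    have "p \<in> I" unfolding I_def using that by (intro S.span_base) auto
    moreover have "p - (\<lambda>_. p x) \<in> I" using ev X that unfolding S_def by blast
    ultimately have "p - (p - (\<lambda>_. p x)) \<in> I" unfolding I_def by (rule S.span_diff)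
    then have "(\<lambda>_. inverse (p x)) * (p - (p - (\<lambda>_. p x))) \<in> I"
      unfolding I_def by (intro S.span_mult S.const_mem)
    moreover have "(\<lambda>_. inverse (p x)) * (p - (p - (\<lambda>_. p x))) = f ^ 0"
      using nz by (simp add: fun_eq_iff)
    ultimately show False using c[of 0] unfolding I_def by metis
  qed
  then have "f x = 0" using van by blast
  then have "f - 0 \<in> I" using ev[of f] f unfolding S_def[symmetric] by (simp add: zero_fun_def)
  then show False using c[of 1] unfolding I_def by simp
qed

subsection \<open>Complements for reductive groups\<close>

lemma group_GL:
  assumes "vector_space s"
  shows "group (GL s)"
proof (rule groupI)
  fix x assume "x \<in> carrier (GL s)"
  then have x: "Vector_Spaces.linear s s x" "bij x" by (auto simp: GL_def)
  have "Vector_Spaces.linear s s (inv_into UNIV x)"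
    unfolding Vector_Spaces.linear_iff
  proof (intro conjI allI)
    fix a b c
    have "x (inv_into UNIV x a + inv_into UNIV x b) = a + b" "x (s c (inv_into UNIV x a)) = s c a"
      using x by (auto simp: Vector_Spaces.linear_iff bij_is_surj surj_f_inv_f)
    then show "inv_into UNIV x (a + b) = inv_into UNIV x a + inv_into UNIV x b" "inv_into UNIV x (s c a) = s c (inv_into UNIV x a)"
      using x(2) by (metis bij_is_inj inv_f_f)+
  qed fact+
  then show "\<exists>y\<in>carrier (GL s). y \<otimes>\<^bsub>GL s\<^esub> x = \<one>\<^bsub>GL s\<^esub>"
    using x by (intro bexI[of _ "inv_into UNIV x"]) (auto simp: GL_def bij_imp_bij_inv bij_is_inj)
qed (use assms in \<open>auto simp: GL_def Vector_Spaces.linear_iff bij_comp o_assoc\<close>)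

definition vec_of :: "(nat \<Rightarrow> 'y) \<Rightarrow> nat \<Rightarrow> ('y \<Rightarrow> complex) \<Rightarrow> complex vec" where
  "vec_of b m f = vec m (\<lambda>i. f (b i))"

text \<open>
  Evaluation at an interpolating set of points identifies a finite-dimensional space of functions
  with column vectors, and the matrix coefficients of the resulting representation are themselves
  values of functions of the space.
\<close>

lemma reductive_complement:
  fixes s :: "complex \<Rightarrow> 'v::ab_group_add \<Rightarrow> 'v" and M :: "('y \<Rightarrow> complex) set"
  assumes "vector_space s" and red: "reductive_group s G" and "finite M"
    and act_one: "\<And>y. act id y = y"
    and act_mult: "\<And>g h y. g \<in> G \<Longrightarrow> h \<in> G \<Longrightarrow> act (g \<circ> h) y = act h (act g y)"
    and stable: "\<And>f g. f \<in> lin_span M \<Longrightarrow> g \<in> G \<Longrightarrow> f \<circ> act g \<in> lin_span M"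
    and regular: "\<And>f y. f \<in> lin_span M \<Longrightarrow> \<exists>p\<in>regular_functions_GL s. \<forall>g\<in>G. f (act g y) = p g"
    and K: "K \<subseteq> lin_span M" "0 \<in> K" "\<And>f h. f \<in> K \<Longrightarrow> h \<in> K \<Longrightarrow> f + h \<in> K"
      "\<And>c f. f \<in> K \<Longrightarrow> (\<lambda>_. c) * f \<in> K" "\<And>f g. f \<in> K \<Longrightarrow> g \<in> G \<Longrightarrow> f \<circ> act g \<in> K"
  shows "\<exists>W. W \<subseteq> lin_span M \<and> (\<forall>f\<in>W. \<forall>h\<in>W. f - h \<in> W) \<and> (\<forall>f\<in>W. \<forall>g\<in>G. f \<circ> act g \<in> W) \<and>
    K \<inter> W \<subseteq> {0} \<and> (\<forall>f\<in>lin_span M. \<exists>k\<in>K. \<exists>w\<in>W. f = k + w)"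
proof -
  define E where "E = lin_span M"
  interpret GL: group "GL s" by (rule group_GL) fact
  have G: "subgroup G (GL s)" and cr: "\<And>m \<rho>. rational_representation s G m \<rho> \<Longrightarrow> completely_reducible G m \<rho>"
    using red unfolding reductive_group_def by blast+
  have id_G: "id \<in> G" using subgroup.one_closed[OF G] by (simp add: GL_def)
  have comp_G: "g \<circ> h \<in> G" if "g \<in> G" "h \<in> G" for g h
    using subgroup.m_closed[OF G that] by (simp add: GL_def)
  have inv_G: "\<exists>h\<in>G. g \<circ> h = id \<and> h \<circ> g = id" if "g \<in> G" for g
  proof -
    have "g \<in> carrier (GL s)" using that subgroup.subset[OF G] by blast
    then have "g \<circ> inv\<^bsub>GL s\<^esub> g = id" "inv\<^bsub>GL s\<^esub> g \<circ> g = id"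
      using GL.r_inv[of g] GL.l_inv[of g] by (auto simp: GL_def)
    then show ?thesis
      by (intro bexI[of _ "inv\<^bsub>GL s\<^esub> g"] conjI subgroup.m_inv_closed[OF G that])
  qed
  obtain P e where Pe: "finite P \<and> (\<forall>p\<in>P. e p \<in> E) \<and>
    (\<forall>p\<in>P. \<forall>q\<in>P. e p q = (if p = q then 1 else 0)) \<and>
    (\<forall>f\<in>E. \<forall>x. f x = (\<Sum>p\<in>P. f p * e p x))"
    using interpolation_basis[OF \<open>finite M\<close>] unfolding E_def by (elim exE)
  then have P: "finite P" "\<And>p. p \<in> P \<Longrightarrow> e p \<in> E"
    "\<And>p q. p \<in> P \<Longrightarrow> q \<in> P \<Longrightarrow> e p q = (if p = q then 1 else 0)"
    by simp_all
  have P4: "f x = (\<Sum>p\<in>P. f p * e p x)" if "f \<in> E" for f x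
    using Pe that by blast
  define m where "m = card P"
  obtain b where b: "bij_betw b {0..<m} P"
    using ex_bij_betw_nat_finite[OF P(1)] unfolding m_def by blast
  have bP: "b i \<in> P" if "i < m" for i using b that by (auto simp: bij_betw_def)
  have expand: "f x = (\<Sum>j\<in>{0..<m}. f (b j) * e (b j) x)" if "f \<in> E" for f x
    using P4[OF that, of x] sum.reindex_bij_betw[OF b, of "\<lambda>p. f p * e p x"] by simp
  have eb: "e (b i) (b j) = (if i = j then 1 else 0)" if "i < m" "j < m" for i j
    using P(3)[OF bP bP] that b by (auto simp: bij_betw_def inj_on_def)
  \<comment> \<open>The inverse of \<open>vec_of b m\<close> on \<open>E\<close>: a vector of
    prescribed values at the points \<open>b j\<close> is interpolated.\<close>
  define comb where "comb w = (\<Sum>j\<in>{0..<m}. (\<lambda>_. w $ j) * e (b j))" for w :: "complex vec"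
  have comb_apply: "comb w x = (\<Sum>j\<in>{0..<m}. w $ j * e (b j) x)" for w x
    by (simp add: comb_def sum_fun_apply)
  have comb_E: "comb w \<in> E" for w
    unfolding comb_def E_def using P(2) bP unfolding E_def
    by (intro constants.span_sum lin_span_scale) auto
  have vec_comb: "vec_of b m (comb w) = w" if "w \<in> carrier_vec m" for w
  proof
    show "dim_vec (vec_of b m (comb w)) = dim_vec w" using that by (simp add: vec_of_def)
    fix i assume "i < dim_vec w"
    then have i: "i < m" using that by simp
    have "comb w (b i) = (\<Sum>j\<in>{0..<m}. if j = i then w $ j else 0)"
      unfolding comb_apply using i by (intro sum.cong) (auto simp: eb)
    then show "vec_of b m (comb w) $ i = w $ i" using i by (simp add: vec_of_def)
  qed
  have comb_vec: "comb (vec_of b m f) = f" if "f \<in> E" for f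
  proof
    fix x
    have "comb (vec_of b m f) x = (\<Sum>j\<in>{0..<m}. f (b j) * e (b j) x)"
      unfolding comb_apply by (intro sum.cong) (auto simp: vec_of_def)
    then show "comb (vec_of b m f) x = f x" using expand[OF that, of x] by simp
  qed
  have vec_add: "vec_of b m (f + h) = vec_of b m f + vec_of b m h" for f h
    by (auto simp: vec_of_def)
  have vec_scale: "vec_of b m ((\<lambda>_. c) * f) = c \<cdot>\<^sub>v vec_of b m f" for c f
    by (auto simp: vec_of_def)
  have vec_carrier: "vec_of b m f \<in> carrier_vec m" for f by (simp add: vec_of_def)
  \<comment> \<open>The matrix of precomposition with \<open>act g\<close> in the coordinates given
    by the points \<open>b i\<close>. Since \<open>act\<close> reverses products, precomposition
    preserves them and \<open>\<rho>\<close> is a homomorphism.\<close>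
  define \<rho> where "\<rho> g = mat m m (\<lambda>(i, j). e (b j) (act g (b i)))" for g
  have \<rho>_carrier: "\<rho> g \<in> carrier_mat m m" for g by (simp add: \<rho>_def)
  have \<rho>_vec: "\<rho> g *\<^sub>v vec_of b m f = vec_of b m (f \<circ> act g)" if "f \<in> E" for f g
  proof
    fix i assume "i < dim_vec (vec_of b m (f \<circ> act g))"
    then have i: "i < m" by (simp add: vec_of_def)
    have "(\<rho> g *\<^sub>v vec_of b m f) $ i = (\<Sum>j\<in>{0..<m}. e (b j) (act g (b i)) * f (b j))"
      using i by (simp add: \<rho>_def vec_of_def scalar_prod_def)
    also have "\<dots> = f (act g (b i))"
      unfolding expand[OF that, of "act g (b i)"] by (intro sum.cong refl mult.commute)
    finally show "(\<rho> g *\<^sub>v vec_of b m f) $ i = vec_of b m (f \<circ> act g) $ i"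
      using i by (simp add: vec_of_def)
  qed (simp add: \<rho>_def vec_of_def)
  have \<rho>_mult: "\<rho> (g \<circ> h) = \<rho> g * \<rho> h" if "g \<in> G" "h \<in> G" for g h
  proof
    fix i k assume "i < dim_row (\<rho> g * \<rho> h)" "k < dim_col (\<rho> g * \<rho> h)"
    then have ik: "i < m" "k < m" by (auto simp: \<rho>_def)
    have "e (b k) \<circ> act h \<in> E" using stable P(2) bP ik that unfolding E_def by blast
    from expand[OF this, of "act g (b i)"]
    have "(\<rho> g * \<rho> h) $$ (i, k) = e (b k) (act h (act g (b i)))"
      using ik by (simp add: \<rho>_def scalar_prod_def mult.commute)
    then show "\<rho> (g \<circ> h) $$ (i, k) = (\<rho> g * \<rho> h) $$ (i, k)"
      using ik that by (simp add: \<rho>_def act_mult)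
  qed (auto simp: \<rho>_def)
  have \<rho>_one: "\<rho> id = 1\<^sub>m m" by (rule eq_matI) (auto simp: \<rho>_def act_one eb)
  have "\<rho> g \<in> Units (ring_mat TYPE(complex) m ())" if g: "g \<in> G" for g
  proof -
    obtain h where h: "h \<in> G" "g \<circ> h = id" "h \<circ> g = id" using inv_G[OF g] by blast
    have "\<rho> h * \<rho> g = 1\<^sub>m m" "\<rho> g * \<rho> h = 1\<^sub>m m"
      using \<rho>_mult[OF h(1) g] \<rho>_mult[OF g h(1)] h \<rho>_one by simp_all
    then show ?thesis using \<rho>_carrier unfolding Units_def ring_mat_simps by blast
  qed
  then have "\<rho> \<in> hom ((GL s)\<lparr>carrier := G\<rparr>) (units_of (ring_mat TYPE(complex) m ()))"
    by (auto simp: hom_def units_of_def ring_mat_simps GL_def \<rho>_mult)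
  moreover have "\<exists>p\<in>regular_functions_GL s. \<forall>g\<in>G. \<rho> g $$ (i, j) = p g" if "i < m" "j < m" for i j
    using regular[of "e (b j)" "b i"] P(2) bP that unfolding E_def by (simp add: \<rho>_def)
  ultimately have "rational_representation s G m \<rho>"
    unfolding rational_representation_def by blast
  then have cred: "completely_reducible G m \<rho>" by (rule cr)
  define U where "U = vec_of b m ` K"
  have KE: "f \<in> E" if "f \<in> K" for f using that K(1) unfolding E_def by blast
  have "LinearCombinations.submodule class_ring U (module_vec TYPE(complex) m)"
  proof (rule LinearCombinations.submodule.intro[OF vec_module], unfold module_vec_simps)
    show "U \<subseteq> carrier_vec m" using vec_carrier unfolding U_def by blast
    show "v + w \<in> U" if "v \<in> U" "w \<in> U" for v w
      using that K(3) unfolding U_def by (auto simp flip: vec_add)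
    have "vec_of b m 0 = 0\<^sub>v m" by (auto simp: vec_of_def)
    then show "0\<^sub>v m \<in> U" using K(2) unfolding U_def by (metis image_eqI)
    show "c \<cdot>\<^sub>v v \<in> U" if "c \<in> carrier class_ring" "v \<in> U" for c v
      using that K(4) unfolding U_def by (auto simp flip: vec_scale)
  qed
  then have "VectorSpace.subspace class_ring U (module_vec TYPE(complex) m)"
    by (simp add: VectorSpace.subspace_def vec_vs)
  moreover have "\<rho> g *\<^sub>v u \<in> U" if "g \<in> G" "u \<in> U" for g u
    using that \<rho>_vec[OF KE] K(5) unfolding U_def by auto
  ultimately have "stable_subspace G m \<rho> U" unfolding stable_subspace_def by blast
  then obtain W where W: "stable_subspace G m \<rho> W" "U \<inter> W = {0\<^sub>v m}"
    "\<And>x. x \<in> carrier_vec m \<Longrightarrow> \<exists>u\<in>U. \<exists>w\<in>W. x = u + w"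
    using cred unfolding completely_reducible_def by meson
  then have Wsub: "LinearCombinations.submodule class_ring W (module_vec TYPE(complex) m)"
    and Wst: "\<And>g w. g \<in> G \<Longrightarrow> w \<in> W \<Longrightarrow> \<rho> g *\<^sub>v w \<in> W"
    unfolding stable_subspace_def VectorSpace.subspace_def by blast+
  have W_carrier: "W \<subseteq> carrier_vec m"
    using LinearCombinations.submodule.subset[OF Wsub] by (simp add: module_vec_simps)
  have W_add: "v + w \<in> W" if "v \<in> W" "w \<in> W" for v w
    using LinearCombinations.submodule.m_closed[OF Wsub that] by (simp add: module_vec_simps)
  have W_scale: "c \<cdot>\<^sub>v w \<in> W" if "w \<in> W" for c w
    using LinearCombinations.submodule.smult_closed[OF Wsub _ that] by (simp add: module_vec_simps)
  \<comment> \<open>The complement of column vectors, carried back to functions.\<close>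
  define W' where "W' = {f \<in> E. vec_of b m f \<in> W}"
  have "f - h \<in> W'" if "f \<in> W'" "h \<in> W'" for f h
  proof -
    have fh: "f \<in> E" "h \<in> E" "vec_of b m f \<in> W" "vec_of b m h \<in> W" using that by (auto simp: W'_def)
    have "vec_of b m f + (- 1) \<cdot>\<^sub>v vec_of b m h \<in> W" using fh by (intro W_add W_scale)
    also have "vec_of b m f + (- 1) \<cdot>\<^sub>v vec_of b m h = vec_of b m (f - h)"
      by (auto simp: vec_of_def)
    finally show ?thesis using fh unfolding W'_def E_def by (auto intro: constants.span_diff)
  qed
  moreover have "f \<circ> act g \<in> W'" if "f \<in> W'" "g \<in> G" for f g
  proof -
    have f: "f \<in> E" "vec_of b m f \<in> W" using that by (auto simp: W'_def)
    then have "vec_of b m (f \<circ> act g) \<in> W" using \<rho>_vec Wst that by metis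
    then show ?thesis using f stable that unfolding W'_def E_def by blast
  qed
  moreover have "K \<inter> W' \<subseteq> {0}"
  proof
    fix f assume f: "f \<in> K \<inter> W'"
    then have "vec_of b m f \<in> U \<inter> W" unfolding U_def W'_def by blast
    then have "vec_of b m f = 0\<^sub>v m" using W(2) by blast
    then have "f = comb (0\<^sub>v m)" using comb_vec f unfolding W'_def by force
    also have "\<dots> = 0" by (auto simp: fun_eq_iff comb_apply)
    finally show "f \<in> {0}" by simp
  qed
  moreover have "\<exists>k\<in>K. \<exists>w\<in>W'. f = k + w" if f: "f \<in> E" for f
  proof -
    obtain u w where uw: "u \<in> U" "w \<in> W" "vec_of b m f = u + w"
      using W(3)[OF vec_carrier] by blast
    then obtain k where k: "k \<in> K" "u = vec_of b m k" unfolding U_def by blast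
    have wm: "w \<in> carrier_vec m" using uw W_carrier by blast
    have "comb w \<in> W'" unfolding W'_def using comb_E vec_comb[OF wm] uw by simp
    moreover have "f = k + comb w"
    proof -
      have "vec_of b m (k + comb w) = vec_of b m f" by (simp add: vec_add vec_comb[OF wm] uw k)
      moreover have "k + comb w \<in> E" using KE[OF k(1)] comb_E unfolding E_def by (rule ideal_span_add)
      ultimately show ?thesis using comb_vec f by metis
    qed
    ultimately show ?thesis using k by blast
  qed
  moreover have "W' \<subseteq> E" unfolding W'_def by blast
  ultimately show ?thesis
    unfolding E_def[symmetric] by (intro exI[of _ W'] conjI ballI) simp_all
qed

subsection \<open>Polynomial functions and invariants\<close>

locale complex_vector_space = finite_dimensional_vector_space s Basis
  for s :: "complex \<Rightarrow> 'v::ab_group_add \<Rightarrow> 'v" and Basis :: "'v set"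
begin

definition coords :: "('v \<Rightarrow> complex) set" where
  "coords = (\<lambda>b v. representation Basis v b) ` Basis"

lemma vs: "vector_space s"
  by unfold_locales

lemma finite_coords: "finite coords"
  by (simp add: coords_def finite_Basis)

lemma linear_coord: "Vector_Spaces.linear s (*) (\<lambda>v. representation Basis v b)"
  using linear_representation[OF independent_Basis span_Basis] .

lemma coords_dual: "coords \<subseteq> dual_space s"
  by (auto simp: coords_def dual_space_def linear_coord)

lemma dual_apply:
  assumes "\<phi> \<in> dual_space s"
  shows "\<phi> (x + y) = \<phi> x + \<phi> y" "\<phi> (s c x) = c * \<phi> x"
  using assms by (auto simp: dual_space_def Vector_Spaces.linear_iff)

lemma dual_sum:
  assumes "\<phi> \<in> dual_space s"
  shows "\<phi> (\<Sum>i\<in>I. s (c i) (x i)) = (\<Sum>i\<in>I. c i * \<phi> (x i))"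
proof -
  have "\<phi> 0 = 0" using dual_apply(2)[OF assms, of 0 0] by simp
  then show ?thesis
    by (induction I rule: infinite_finite_induct) (auto simp: dual_apply[OF assms])
qed

lemma basis_expand: "(\<Sum>b\<in>Basis. s (representation Basis v b) b) = v"
  using sum_representation_eq[OF independent_Basis, of v Basis] finite_Basis span_Basis by auto

lemma dual_subset: "dual_space s \<subseteq> lin_span coords"
proof
  fix \<phi> assume \<phi>: "\<phi> \<in> dual_space s"
  have "\<phi> = (\<Sum>b\<in>Basis. (\<lambda>_. \<phi> b) * (\<lambda>v. representation Basis v b))"
  proof
    fix v
    have "\<phi> v = \<phi> (\<Sum>b\<in>Basis. s (representation Basis v b) b)" by (simp add: basis_expand)
    also have "\<dots> = (\<Sum>b\<in>Basis. \<phi> b * representation Basis v b)"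
      unfolding dual_sum[OF \<phi>] by (simp add: mult.commute)
    finally show "\<phi> v = (\<Sum>b\<in>Basis. (\<lambda>_. \<phi> b) * (\<lambda>v. representation Basis v b)) v"
      by (simp add: sum_fun_apply)
  qed
  also have "\<dots> \<in> lin_span coords"
    by (intro constants.span_sum lin_span_scale constants.span_base) (auto simp: coords_def)
  finally show "\<phi> \<in> lin_span coords" .
qed

text \<open>Linear coordinates can be prescribed independently; this discharges the hypothesis
  \<open>surj\<close> of \<open>nullstellensatz\<close>.\<close>

lemma coords_surj: "\<exists>x. \<forall>t\<in>coords. t x = c t"
proof -
  define k where "k b = (\<lambda>v. representation Basis v b)" for b
  define x where "x = (\<Sum>b\<in>Basis. s (c (k b)) b)"
  have "k b x = c (k b)" if "b \<in> Basis" for b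
  proof -
    have "k b \<in> dual_space s" using coords_dual that by (auto simp: coords_def k_def)
    then have "k b x = (\<Sum>a\<in>Basis. c (k a) * k b a)" unfolding x_def by (rule dual_sum)
    also have "\<dots> = (\<Sum>a\<in>Basis. if a = b then c (k b) else 0)"
      by (intro sum.cong) (auto simp: k_def representation_basis[OF independent_Basis])
    finally show ?thesis using that finite_Basis by simp
  qed
  then show ?thesis by (auto simp: coords_def k_def)
qed

abbreviation R :: "('v \<Rightarrow> complex) set" where
  "R \<equiv> polynomial_functions s"

sublocale R: function_algebra R
  unfolding polynomial_functions_def by (rule function_algebra_generated)

text \<open>Replaces the infinite generating set \<open>dual_space s\<close> by a finite one, as
  needed for Noetherianity and the Nullstellensatz.\<close>

lemma R_coords: "R = generated_algebra coords"
proof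
  interpret C: function_algebra "generated_algebra coords" by (rule function_algebra_generated)
  have "coords \<subseteq> generated_algebra coords" by (auto intro: generated_algebra.gen)
  then have "lin_span coords \<subseteq> generated_algebra coords"
    using C.lin_span_subset_span C.span_carrier by blast
  then show "R \<subseteq> generated_algebra coords"
    unfolding polynomial_functions_def using dual_subset
    by (intro generated_algebra_least function_algebra_generated) blast
  show "generated_algebra coords \<subseteq> R"
    using coords_dual unfolding polynomial_functions_def
    by (intro generated_algebra_least function_algebra_generated) (auto intro: generated_algebra.gen)
qed

lemma noetherian_R: "noetherian R"
  unfolding R_coords by (rule noetherian_generated_algebra[OF finite_coords])

lemma nullstellensatz_R:
  assumes "X \<subseteq> R" "f \<in> R" "\<And>x. (\<And>p. p \<in> X \<Longrightarrow> p x = 0) \<Longrightarrow> f x = 0"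
  shows "\<exists>n. f ^ n \<in> ideal_span R X"
  using nullstellensatz[OF finite_coords coords_surj, of X f] assms unfolding R_coords by blast

lemma dual_comp:
  assumes "Vector_Spaces.linear s s g" "\<phi> \<in> dual_space s"
  shows "\<phi> \<circ> g \<in> dual_space s"
  using assms by (simp add: dual_space_def Vector_Spaces.linear_iff)

text \<open>Counting degree by all linear forms instead of coordinates makes the bound stable under
  linear substitution, so functions of bounded degree form a representation.\<close>

lemma degree_le_comp:
  assumes g: "Vector_Spaces.linear s s g" and "degree_le (dual_space s) d f"
  shows "degree_le (dual_space s) d (\<lambda>v. f (g v))"
  using assms(2)
proof induction
  case (const d c)
  show ?case by (rule degree_le.const)
next
  case (add d f h)
  have "degree_le (dual_space s) d ((\<lambda>v. f (g v)) + (\<lambda>v. h (g v)))"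
    by (rule degree_le.add) fact+
  then show ?case by (simp add: plus_fun_def)
next
  case (mult t d f)
  have "degree_le (dual_space s) (Suc d) ((t \<circ> g) * (\<lambda>v. f (g v)))"
    by (rule degree_le.mult[OF dual_comp[OF g]]) fact+
  then show ?case by (simp add: times_fun_def)
next
  case (Suc d f)
  show ?case by (rule degree_le.Suc) fact
qed

lemma polynomial_comp:
  assumes "Vector_Spaces.linear s s g" "f \<in> R"
  shows "(\<lambda>v. f (g v)) \<in> R"
  using degree_le_exists[of f "dual_space s"] degree_le_comp[OF assms(1)] degree_le_generated assms(2)
  unfolding polynomial_functions_def by blast

lemma regular_matrix_coeff:
  assumes "p \<in> R"
  shows "(\<lambda>g. p (g v)) \<in> regular_functions_GL s"
  using assms unfolding polynomial_functions_def
proof induction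
  case (gen f)
  then show ?case unfolding regular_functions_GL_def by (intro generated_algebra.gen) blast
qed (auto simp: regular_functions_GL_def intro: generated_algebra.intros)

lemma regular_inverse_coeff:
  assumes "p \<in> R"
  shows "(\<lambda>g. p ((inv\<^bsub>GL s\<^esub> g) v)) \<in> regular_functions_GL s"
  using assms unfolding polynomial_functions_def
proof induction
  case (gen f)
  then show ?case unfolding regular_functions_GL_def by (intro generated_algebra.gen) blast
qed (auto simp: regular_functions_GL_def intro: generated_algebra.intros)

lemma function_algebra_invariants: "function_algebra (invariants s G)"
  by standard (auto simp: invariants_def intro: R.const_mem R.add_mem R.mult_mem)

lemma invariants_subset: "invariants s G \<subseteq> R"
  by (auto simp: invariants_def)

text \<open>
  Extended ideals contract: a relation with polynomial coefficients among invariants can be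
  replaced by one with invariant coefficients. The coefficient vectors form a representation of
  the group, and an invariant one is obtained from a complement of the vectors of relations.
\<close>

lemma invariants_contract:
  assumes red: "reductive_group s G" and "finite Y" and Y: "Y \<subseteq> invariants s G"
    and b: "b \<in> invariants s G" "b \<in> ideal_span R Y"
  shows "b \<in> ideal_span (invariants s G) Y"
proof -
  let ?deg = "degree_le (dual_space s)"
  interpret GL: group "GL s" by (rule group_GL[OF vs])
  interpret B: function_algebra "invariants s G" by (rule function_algebra_invariants)
  have G: "subgroup G (GL s)" using red unfolding reductive_group_def by blast
  have lin: "Vector_Spaces.linear s s (inv\<^bsub>GL s\<^esub> g)" if "g \<in> G" for g
    using subgroup.subset[OF G] subgroup.m_inv_closed[OF G that] by (auto simp: GL_def)
  have invar: "y ((inv\<^bsub>GL s\<^esub> g) v) = y v" if "y \<in> invariants s G" "g \<in> G" for y g v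
    using subgroup.m_inv_closed[OF G that(2)] that(1) by (simp add: invariants_def)
  obtain h where h: "\<And>y. y \<in> Y \<Longrightarrow> h y \<in> R" "b = (\<Sum>y\<in>Y. h y * y)"
    using b(2) unfolding R.span_finite_iff[OF \<open>finite Y\<close>] by blast
  have "\<forall>y. \<exists>d. y \<in> Y \<longrightarrow> ?deg d (h y)"
    using h(1) degree_le_exists unfolding polynomial_functions_def by blast
  then obtain dd where dd: "\<And>y. y \<in> Y \<Longrightarrow> ?deg (dd y) (h y)" by metis
  \<comment> \<open>Any common bound for the degrees of the coefficients works; fixing one confines
    the coefficient tuples to a finite-dimensional space.\<close>
  define d where "d = (\<Sum>y\<in>Y. dd y)"
  have hd: "?deg d (h y)" if "y \<in> Y" for y
    using dd[OF that] degree_le_mono[of "dd y" d] member_le_sum[OF that, of dd] \<open>finite Y\<close>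
    unfolding d_def by blast
  obtain M where M: "finite M" "{f. ?deg d f} = lin_span M"
    using degree_le_finite_dim[OF finite_coords coords_dual dual_subset] by blast
  have dM: "?deg d f \<longleftrightarrow> f \<in> lin_span M" for f using M(2) by blast
  \<comment> \<open>A tuple of functions indexed by \<open>Y\<close> is encoded as one function on
    pairs whose second component names the index, because \<open>reductive_complement\<close> treats
    spaces of functions on a single set. \<open>single y f\<close> has \<open>f\<close> in position
    \<open>y\<close> and 0 elsewhere.\<close>
  define single where "single y f = (\<lambda>(v, y'). if y' = y then f v else 0)"
    for y :: "'v \<Rightarrow> complex" and f :: "'v \<Rightarrow> complex"
  define N where "N = (\<Union>y\<in>Y. single y ` M)"
  have finN: "finite N" unfolding N_def using M(1) \<open>finite Y\<close> by blast
  have fib: "(\<lambda>v. H (v, y)) \<in> lin_span M \<and> (y \<notin> Y \<longrightarrow> (\<forall>v. H (v, y) = 0))"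
    if "H \<in> lin_span N" for H y
    using that
  proof induction
    case zero
    have "(0 :: 'v \<Rightarrow> complex) \<in> lin_span M" by (rule ideal_span.zero)
    then show ?case by (simp add: zero_fun_def)
  next
    case (step c x H)
    obtain a where a: "c = (\<lambda>_. a)" using step(1) unfolding constants_def by (elim rangeE)
    obtain z m where z: "z \<in> Y" "m \<in> M" "x = single z m" using step(2) unfolding N_def by blast
    have eq: "(\<lambda>v. (c * x + H) (v, y)) = (\<lambda>_. if y = z then a else 0) * m + (\<lambda>v. H (v, y))"
      by (auto simp: a z single_def fun_eq_iff)
    have "(\<lambda>v. (c * x + H) (v, y)) \<in> lin_span M"
      unfolding eq by (intro ideal_span_add[OF lin_span_scale] constants.span_base z conjunct1[OF step.IH])
    moreover have "(c * x + H) (v, y) = 0" if "y \<notin> Y" for v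
      using step.IH that z by (auto simp: single_def)
    ultimately show ?case by simp
  qed
  have single_N: "single y f \<in> lin_span N" if "y \<in> Y" "f \<in> lin_span M" for y f
    using that(2)
  proof induction
    case zero
    have "single y 0 = 0" by (auto simp: single_def)
    then show "single y 0 \<in> lin_span N" by (simp only: ideal_span.zero)
  next
    case (step c x f)
    obtain a where a: "c = (\<lambda>_. a)" using step(1) unfolding constants_def by (elim rangeE)
    have eq: "single y (c * x + f) = (\<lambda>_. a) * single y x + single y f"
      by (auto simp: a single_def fun_eq_iff)
    have "single y x \<in> lin_span N"
      using step(2) that(1) unfolding N_def by (intro constants.span_base) blast
    then show "single y (c * x + f) \<in> lin_span N"
      unfolding eq by (intro ideal_span_add[OF lin_span_scale] step.IH)
  qed
  have N_I: "H \<in> lin_span N" if "\<And>y. y \<in> Y \<Longrightarrow> (\<lambda>v. H (v, y)) \<in> lin_span M"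
    "\<And>v y. y \<notin> Y \<Longrightarrow> H (v, y) = 0" for H
  proof -
    have "H = (\<Sum>y\<in>Y. single y (\<lambda>v. H (v, y)))"
    proof
      fix x :: "'v \<times> ('v \<Rightarrow> complex)"
      obtain v y' where x: "x = (v, y')" by (cases x)
      have "(\<Sum>y\<in>Y. single y (\<lambda>v. H (v, y)) x) = (\<Sum>y\<in>Y. if y = y' then H (v, y') else 0)"
        by (intro sum.cong) (auto simp: x single_def)
      then show "H x = (\<Sum>y\<in>Y. single y (\<lambda>v. H (v, y))) x"
        using that(2) \<open>finite Y\<close> by (auto simp: x sum_fun_apply)
    qed
    also have "\<dots> \<in> lin_span N" by (intro constants.span_sum single_N that)
    finally show ?thesis .
  qed
  \<comment> \<open>The inverse makes \<open>act\<close> reverse products, as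
    \<open>reductive_complement\<close> demands; the group leaves the index alone.\<close>
  define act where "act g = (\<lambda>(v, y). ((inv\<^bsub>GL s\<^esub> g) v, y :: 'v \<Rightarrow> complex))" for g :: "'v \<Rightarrow> 'v"
  define rel where "rel H v = (\<Sum>y\<in>Y. H (v, y) * y v)"
    for H :: "'v \<times> ('v \<Rightarrow> complex) \<Rightarrow> complex" and v
  have rel_act: "rel (H \<circ> act g) v = rel H ((inv\<^bsub>GL s\<^esub> g) v)" if "g \<in> G" for H g v
  proof -
    have "(H \<circ> act g) (v, y) * y v = H ((inv\<^bsub>GL s\<^esub> g) v, y) * y ((inv\<^bsub>GL s\<^esub> g) v)"
      if "y \<in> Y" for y
    proof -
      have "y ((inv\<^bsub>GL s\<^esub> g) v) = y v" using invar[OF _ \<open>g \<in> G\<close>] Y that by blast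
      then show ?thesis by (simp add: act_def)
    qed
    then show ?thesis unfolding rel_def by (intro sum.cong refl)
  qed
  \<comment> \<open>The syzygies of bounded degree: the kernel of \<open>rel\<close>, stable under
    the group because \<open>rel\<close> is equivariant by \<open>rel_act\<close>.\<close>
  define K where "K = {H \<in> lin_span N. \<forall>v. rel H v = 0}"
  have act_N: "H \<circ> act g \<in> lin_span N" if "H \<in> lin_span N" "g \<in> G" for H g
  proof (rule N_I)
    fix y assume "y \<in> Y"
    have "?deg d (\<lambda>v. H (v, y))" using fib[OF that(1)] dM by blast
    then have "?deg d (\<lambda>v. H ((inv\<^bsub>GL s\<^esub> g) v, y))" by (rule degree_le_comp[OF lin[OF that(2)]])
    then show "(\<lambda>v. (H \<circ> act g) (v, y)) \<in> lin_span M" using dM by (simp add: act_def)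
  qed (use fib[OF that(1)] in \<open>auto simp: act_def\<close>)
  have "\<exists>W. W \<subseteq> lin_span N \<and> (\<forall>f\<in>W. \<forall>h\<in>W. f - h \<in> W) \<and> (\<forall>f\<in>W. \<forall>g\<in>G. f \<circ> act g \<in> W) \<and>
    K \<inter> W \<subseteq> {0} \<and> (\<forall>f\<in>lin_span N. \<exists>k\<in>K. \<exists>w\<in>W. f = k + w)"
  proof (rule reductive_complement[OF vs red finN])
    have "inv\<^bsub>GL s\<^esub> id = id" using GL.inv_one by (simp add: GL_def)
    then show "act id y = y" for y by (cases y) (simp add: act_def)
    show "act (g \<circ> h) y = act h (act g y)" if "g \<in> G" "h \<in> G" for g h y
    proof -
      have "inv\<^bsub>GL s\<^esub> (g \<otimes>\<^bsub>GL s\<^esub> h) = inv\<^bsub>GL s\<^esub> h \<otimes>\<^bsub>GL s\<^esub> inv\<^bsub>GL s\<^esub> g"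
        using that subgroup.subset[OF G] by (intro GL.inv_mult_group) auto
      then have "inv\<^bsub>GL s\<^esub> (g \<circ> h) = inv\<^bsub>GL s\<^esub> h \<circ> inv\<^bsub>GL s\<^esub> g" by (simp add: GL_def)
      then show ?thesis by (cases y) (simp add: act_def)
    qed
    show "H \<circ> act g \<in> lin_span N" if "H \<in> lin_span N" "g \<in> G" for H g by (rule act_N[OF that])
    show "\<exists>p\<in>regular_functions_GL s. \<forall>g\<in>G. H (act g x) = p g" if "H \<in> lin_span N" for H x
    proof -
      obtain v y where x: "x = (v, y)" by (cases x)
      have "?deg d (\<lambda>v. H (v, y))" using fib[OF that] dM by blast
      then have "(\<lambda>v. H (v, y)) \<in> R" unfolding polynomial_functions_def by (rule degree_le_generated)
      from regular_inverse_coeff[OF this, of v]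
      show ?thesis by (intro bexI) (auto simp: x act_def)
    qed
    show "K \<subseteq> lin_span N" "0 \<in> K" by (auto simp: K_def rel_def ideal_span.zero)
    show "f + h \<in> K" if "f \<in> K" "h \<in> K" for f h
      using that by (auto simp: K_def rel_def distrib_right sum.distrib intro: ideal_span_add)
    show "(\<lambda>_. c) * f \<in> K" if "f \<in> K" for c f
      using that
      by (auto simp: K_def rel_def mult.assoc simp flip: sum_distrib_left intro: lin_span_scale)
    show "f \<circ> act g \<in> K" if "f \<in> K" "g \<in> G" for f g
      using that act_N rel_act by (simp add: K_def)
  qed
  then obtain W where W: "W \<subseteq> lin_span N" "\<forall>f\<in>W. \<forall>h\<in>W. f - h \<in> W" "\<forall>f\<in>W. \<forall>g\<in>G. f \<circ> act g \<in> W"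
    "K \<inter> W \<subseteq> {0}" "\<forall>f\<in>lin_span N. \<exists>k\<in>K. \<exists>w\<in>W. f = k + w"
    by (elim exE conjE)
  define H0 where "H0 = (\<lambda>(v, y). if y \<in> Y then h y v else 0)"
  have "H0 \<in> lin_span N"
    by (rule N_I) (use hd dM in \<open>auto simp: H0_def\<close>)
  then obtain k w where kw: "k \<in> K" "w \<in> W" "H0 = k + w" using W(5) by blast
  have rel_w: "rel w v = b v" for v
  proof -
    have "rel H0 v = rel k v + rel w v" by (simp add: kw(3) rel_def distrib_right sum.distrib)
    moreover have "rel k v = 0" using kw(1) by (simp add: K_def)
    moreover have "rel H0 v = b v" by (simp add: rel_def H0_def h(2) sum_fun_apply)
    ultimately show ?thesis by simp
  qed
  \<comment> \<open>\<open>w\<close> and its translate both represent the invariant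
    \<open>b\<close>, so their difference is a syzygy; it also lies in the complement
    \<open>W\<close>, hence is zero.\<close>
  have w_inv: "w \<circ> act g = w" if "g \<in> G" for g
  proof -
    have w1: "(w \<circ> act g) - w \<in> W" using W(2,3) kw(2) that by blast
    have "rel ((w \<circ> act g) - w) v = 0" for v
    proof -
      have "rel ((w \<circ> act g) - w) v = rel (w \<circ> act g) v - rel w v"
        by (simp add: rel_def left_diff_distrib sum_subtractf)
      then show ?thesis using rel_act[OF that] rel_w invar[OF b(1) that] by simp
    qed
    then have "(w \<circ> act g) - w \<in> K \<inter> W" using w1 W(1) by (auto simp: K_def)
    then show ?thesis using W(4) by auto
  qed
  have "(\<lambda>v. w (v, y)) \<in> invariants s G" for y
    unfolding invariants_def
  proof (safe)
    have "?deg d (\<lambda>v. w (v, y))" using fib[of w y] W(1) kw(2) dM by blast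
    then show "(\<lambda>v. w (v, y)) \<in> R" unfolding polynomial_functions_def by (rule degree_le_generated)
    fix g v assume g: "g \<in> G"
    have gG: "g \<in> carrier (GL s)" using subgroup.subset[OF G] g by blast
    have "(inv\<^bsub>GL s\<^esub> g \<otimes>\<^bsub>GL s\<^esub> g) v = v" using GL.l_inv[OF gG] by (simp add: GL_def)
    then have "(inv\<^bsub>GL s\<^esub> g) (g v) = v" by (simp add: GL_def)
    then have "(w \<circ> act g) (g v, y) = w (v, y)" by (simp add: act_def)
    then show "w (g v, y) = w (v, y)" unfolding w_inv[OF g] .
  qed
  moreover have "b = (\<Sum>y\<in>Y. (\<lambda>v. w (v, y)) * y)"
    by (simp add: fun_eq_iff sum_fun_apply flip: rel_w) (simp add: rel_def)
  ultimately show ?thesis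
    unfolding B.span_finite_iff[OF \<open>finite Y\<close>] by (intro exI[of _ "\<lambda>y v. w (v, y)"]) blast
qed

end

subsection \<open>Fibres of the quotient map\<close>

context complex_vector_space
begin

lemma fibre_eq:
  assumes "is_quotient_fiber s G F" "v \<in> F"
  shows "F = {x. \<forall>b\<in>invariants s G. b x = b v}"
proof -
  obtain \<xi> where F: "F = categorical_quotient_map s G -` {\<xi>}"
    using assms(1) unfolding is_quotient_fiber_def by blast
  have "x \<in> F \<longleftrightarrow> categorical_quotient_map s G x = categorical_quotient_map s G v" for x
    using assms(2) unfolding F by auto
  also have "\<dots> x \<longleftrightarrow> (\<forall>b\<in>invariants s G. b x = b v)" for x
    unfolding categorical_quotient_map_def restrict_def fun_eq_iff by meson
  finally show ?thesis by blast
qed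

text \<open>This is surjectivity of the quotient map. If the kernel of the character
  \<open>\<xi>\<close> had no common zero, it would generate the unit ideal of \<open>R\<close>; by
  contraction 1 would be an invariant combination of elements killed by
  \<open>\<xi>\<close>.\<close>

lemma fibre_nonempty:
  assumes red: "reductive_group s G" and "is_quotient_fiber s G F"
  shows "F \<noteq> {}"
proof -
  let ?B = "invariants s G"
  interpret B: function_algebra ?B by (rule function_algebra_invariants)
  obtain \<xi> where \<xi>: "\<xi> \<in> categorical_quotient s G" "F = categorical_quotient_map s G -` {\<xi>}"
    using assms(2) unfolding is_quotient_fiber_def by blast
  have ext: "\<xi> \<in> extensional ?B" and const: "\<And>c. \<xi> (\<lambda>_. c) = c"
    and add: "\<And>f h. f \<in> ?B \<Longrightarrow> h \<in> ?B \<Longrightarrow> \<xi> (f + h) = \<xi> f + \<xi> h"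
    and mult: "\<And>f h. f \<in> ?B \<Longrightarrow> h \<in> ?B \<Longrightarrow> \<xi> (f * h) = \<xi> f * \<xi> h"
    using \<xi>(1) unfolding categorical_quotient_def plus_fun_def times_fun_def by blast+
  define m where "m = {b \<in> ?B. \<xi> b = 0}"
  have mB: "m \<subseteq> ?B" unfolding m_def by blast
  have "\<exists>v. \<forall>b\<in>m. b v = 0"
  proof (rule ccontr)
    assume "\<nexists>v. \<forall>b\<in>m. b v = 0"
    then have "\<exists>n. 1 ^ n \<in> ideal_span R m"
      using mB invariants_subset R.one_mem by (intro nullstellensatz_R) blast+
    then have "1 \<in> ideal_span R m" by simp
    then obtain Y where Y: "Y \<subseteq> m" "finite Y" "1 \<in> ideal_span R Y"
      using ideal_span_finite_support by blast
    have "Y \<subseteq> ?B" using Y(1) mB by blast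
    then have "1 \<in> ideal_span ?B Y"
      using invariants_contract[OF red Y(2) _ B.one_mem Y(3)] by blast
    moreover have "\<xi> g = 0" if "g \<in> ideal_span ?B Y" for g
      using that
    proof induction
      case zero
      show ?case unfolding zero_fun_def by (rule const)
    next
      case (step c x f)
      have x: "x \<in> ?B" "\<xi> x = 0" using step(2) Y(1) unfolding m_def by blast+
      have f: "f \<in> ?B" using step(3) B.span_carrier \<open>Y \<subseteq> ?B\<close> by blast
      have "\<xi> (c * x + f) = \<xi> c * \<xi> x + \<xi> f"
        using add[OF B.mult_mem[OF step(1) x(1)] f] mult[OF step(1) x(1)] by simp
      also have "\<dots> = 0" using x step.IH by simp
      finally show ?case .
    qed
    ultimately have "\<xi> 1 = 0" by blast
    then show False using const[of 1] unfolding one_fun_def by simp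
  qed
  then obtain v where v: "\<And>b. b \<in> m \<Longrightarrow> b v = 0" by blast
  have "\<xi> b = b v" if "b \<in> ?B" for b
  proof -
    have "\<xi> (b + (\<lambda>_. - \<xi> b)) = 0" using add[OF that B.const_mem] const by simp
    then have "b + (\<lambda>_. - \<xi> b) \<in> m" unfolding m_def using B.add_mem[OF that B.const_mem] by blast
    from v[OF this] show ?thesis by simp
  qed
  then have "categorical_quotient_map s G v = \<xi>"
    unfolding categorical_quotient_map_def using ext by (intro extensionalityI[of _ ?B]) auto
  then show ?thesis unfolding \<xi>(2) by blast
qed

subsection \<open>Restriction to lines\<close>

text \<open>For \<open>p\<close> in \<open>R\<close> this is the restriction to a line as a formal
  polynomial, so that order of vanishing at \<open>v\<close> becomes divisibility by a power of
  \<open>[:0, 1:]\<close>. The choice is then unique because the complex numbers are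
  infinite.\<close>

definition line :: "'v \<Rightarrow> 'v \<Rightarrow> ('v \<Rightarrow> complex) \<Rightarrow> complex poly" where
  "line v w p = (SOME P. \<forall>z. poly P z = p (v + s z w))"

lemma poly_line:
  assumes "p \<in> R"
  shows "poly (line v w p) z = p (v + s z w)"
proof -
  have "\<exists>P. \<forall>z. poly P z = p (v + s z w)"
    using assms unfolding polynomial_functions_def
  proof induction
    case (gen f)
    then show ?case by (intro exI[of _ "[:f v, f w:]"]) (simp add: dual_apply)
  next
    case (const c)
    show ?case by (intro exI[of _ "[:c:]"]) simp
  next
    case (add f h)
    then obtain P Q where "\<forall>z. poly P z = f (v + s z w)" "\<forall>z. poly Q z = h (v + s z w)" by blast
    then show ?case by (intro exI[of _ "P + Q"]) simp
  next
    case (mult f h)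
    then obtain P Q where "\<forall>z. poly P z = f (v + s z w)" "\<forall>z. poly Q z = h (v + s z w)" by blast
    then show ?case by (intro exI[of _ "P * Q"]) simp
  qed
  from someI_ex[OF this] show ?thesis unfolding line_def by blast
qed

lemma line_eqI:
  assumes "p \<in> R" "\<And>z. poly P z = p (v + s z w)"
  shows "line v w p = P"
  using assms poly_line[OF assms(1)] by (metis poly_eq_poly_eq_iff ext)

lemma line_add: "p \<in> R \<Longrightarrow> q \<in> R \<Longrightarrow> line v w (p + q) = line v w p + line v w q"
  by (rule line_eqI) (auto simp: poly_line intro: R.add_mem)

lemma line_diff: "p \<in> R \<Longrightarrow> q \<in> R \<Longrightarrow> line v w (p - q) = line v w p - line v w q"
  by (rule line_eqI) (auto simp: poly_line intro: R.diff_mem)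

lemma line_mult: "p \<in> R \<Longrightarrow> q \<in> R \<Longrightarrow> line v w (p * q) = line v w p * line v w q"
  by (rule line_eqI) (auto simp: poly_line intro: R.mult_mem)

lemma line_sum:
  "(\<And>i. i \<in> I \<Longrightarrow> p i \<in> R) \<Longrightarrow> line v w (\<Sum>i\<in>I. p i) = (\<Sum>i\<in>I. line v w (p i))"
  by (rule line_eqI) (auto simp: poly_line poly_sum sum_fun_apply intro: R.sum_mem)

text \<open>On the line joining a point good for \<open>D\<close> to one good for \<open>p\<close>,
  every function in question restricts to a nonzero polynomial, and so does their product; any
  non-root of the product gives the point.\<close>

lemma common_nonzero:
  assumes "finite D" "D \<subseteq> R" "0 \<notin> D"
  shows "\<exists>u. \<forall>p\<in>D. p u \<noteq> 0"
  using assms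
proof (induction D rule: finite_induct)
  case (insert p D)
  then obtain u where u: "\<forall>q\<in>D. q u \<noteq> 0" by auto
  have "p \<noteq> 0" using insert.prems by auto
  then obtain x where x: "p x \<noteq> 0" by (auto simp: fun_eq_iff)
  define L where "L = line u (x - u)"
  have L: "poly (L q) z = q (u + s z (x - u))" if "q \<in> insert p D" for q z
    unfolding L_def using insert.prems that by (intro poly_line) blast
  have "L q \<noteq> 0" if "q \<in> insert p D" for q
  proof
    assume "L q = 0"
    then have "q u = 0" "q x = 0" using L[OF that, of 0] L[OF that, of 1] by simp_all
    then show False using u x that by auto
  qed
  then have "(\<Prod>q\<in>insert p D. L q) \<noteq> 0" using insert.hyps by simp
  then obtain z where "poly (\<Prod>q\<in>insert p D. L q) z \<noteq> 0" using poly_all_0_iff_0 by blast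
  then have "\<forall>q\<in>insert p D. poly (L q) z \<noteq> 0"
    unfolding poly_prod using insert.hyps by simp
  then show ?case using L by (intro exI[of _ "u + s z (x - u)"]) simp
qed simp

text \<open>Applied to the nonzero differences, \<open>common_nonzero\<close> separates finitely
  many functions; this yields a line on which finitely many translates stay distinct.\<close>

lemma separating_point:
  assumes "finite D" "D \<subseteq> R"
  shows "\<exists>u. inj_on (\<lambda>h. h u) D"
proof -
  define D' where "D' = (\<lambda>(p, q). p - q) ` {(p, q) \<in> D \<times> D. p \<noteq> q}"
  have "finite D'" unfolding D'_def
    by (intro finite_imageI finite_subset[OF _ finite_cartesian_product[OF assms(1) assms(1)]]) auto
  moreover have "D' \<subseteq> R" unfolding D'_def using assms(2) by (auto intro: R.diff_mem)
  moreover have "0 \<notin> D'" unfolding D'_def by auto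
  ultimately obtain u where u: "\<forall>p\<in>D'. p u \<noteq> 0" using common_nonzero by blast
  have "p = q" if "p \<in> D" "q \<in> D" "p u = q u" for p q
  proof (rule ccontr)
    assume "p \<noteq> q"
    then have "p - q \<in> D'" unfolding D'_def using that by force
    then show False using u that by auto
  qed
  then show ?thesis by (intro exI[of _ u] inj_onI)
qed

end

subsection \<open>Finite codimension\<close>

context function_algebra
begin

text \<open>Expansion in powers of \<open>z\<close>: the quotient is expanded again and again modulo
  \<open>z\<close>, and after \<open>N\<close> rounds the remainder is a multiple of
  \<open>z ^ N\<close>, hence in the ideal. The products of \<open>E\<close> with the powers of
  \<open>z\<close> below \<open>N\<close> therefore span.\<close>

lemma finite_codim_remove:
  assumes z: "z \<in> S" "z ^ N \<in> ideal_span S X"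
    and E: "finite E" "E \<subseteq> S" "\<And>b. b \<in> S \<Longrightarrow> \<exists>e\<in>lin_span E. b - e \<in> ideal_span S (insert z X)"
  shows "\<exists>E. finite E \<and> E \<subseteq> S \<and> (\<forall>b\<in>S. \<exists>e\<in>lin_span E. b - e \<in> ideal_span S X)"
proof -
  define D where "D n = (\<Union>i<n. (\<lambda>e. z ^ i * e) ` E)" for n :: nat
  have D: "finite (D n)" "D n \<subseteq> S" for n
    unfolding D_def using E z by (auto intro!: mult_mem power_mem)
  have div: "\<exists>e\<in>lin_span (D n). \<exists>q\<in>S. b - e - q * z ^ n \<in> ideal_span S X" if b: "b \<in> S" for n b
  proof (induction n)
    case 0
    have "b - 0 - b * z ^ 0 \<in> ideal_span S X" using ideal_span.zero by simp
    then show ?case using b ideal_span.zero by blast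
  next
    case (Suc n)
    then obtain e q where eq: "e \<in> lin_span (D n)" "q \<in> S" "b - e - q * z ^ n \<in> ideal_span S X"
      by blast
    obtain e' where e': "e' \<in> lin_span E" "q - e' \<in> ideal_span S (insert z X)"
      using E(3)[OF eq(2)] by blast
    obtain q' where q': "q' \<in> S" "q - e' - q' * z \<in> ideal_span S X"
      using span_insert[OF e'(2)] by blast
    have "z ^ n * e' \<in> lin_span (D (Suc n))"
      using e'(1)
    proof induction
      case zero
      show "z ^ n * 0 \<in> lin_span (D (Suc n))" unfolding mult_zero_right by (rule ideal_span.zero)
    next
      case (step c x f)
      have "z ^ n * x \<in> D (Suc n)" unfolding D_def using step(2) by blast
      then have "c * (z ^ n * x) + z ^ n * f \<in> lin_span (D (Suc n))"
        by (rule ideal_span.step[OF step(1) _ step.IH])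
      then show "z ^ n * (c * x + f) \<in> lin_span (D (Suc n))"
        unfolding distrib_left mult.left_commute[of c] .
    qed
    moreover have "e \<in> lin_span (D (Suc n))"
    proof -
      have "D n \<subseteq> D (Suc n)" unfolding D_def by force
      then show ?thesis using eq(1) ideal_span_mono[of constants constants "D n" "D (Suc n)"] by blast
    qed
    ultimately have "e + z ^ n * e' \<in> lin_span (D (Suc n))" by (intro ideal_span_add)
    moreover have "b - (e + z ^ n * e') - q' * z ^ Suc n
        = (b - e - q * z ^ n) + z ^ n * (q - e' - q' * z)" by (simp add: algebra_simps)
    moreover have "(b - e - q * z ^ n) + z ^ n * (q - e' - q' * z) \<in> ideal_span S X"
      by (intro ideal_span_add eq span_mult power_mem z q')
    ultimately show ?case using q'(1) by metis
  qed
  have "\<exists>e\<in>lin_span (D N). b - e \<in> ideal_span S X" if b: "b \<in> S" for b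
  proof -
    obtain e q where eq: "e \<in> lin_span (D N)" "q \<in> S" "b - e - q * z ^ N \<in> ideal_span S X"
      using div[OF b] by blast
    have "(b - e - q * z ^ N) + q * z ^ N \<in> ideal_span S X"
      by (intro ideal_span_add eq span_mult z)
    then show ?thesis using eq(1) by auto
  qed
  then show ?thesis using D[of N] by (intro exI[of _ "D N"]) blast
qed

text \<open>Modulo \<open>Y\<close> only constants remain. The elements of \<open>Y\<close> are then
  removed from the ideal one at a time, each being nilpotent modulo \<open>X\<close>.\<close>

lemma finite_codim:
  assumes "finite Y" "Y \<subseteq> S" "\<And>y. y \<in> Y \<Longrightarrow> \<exists>n. y ^ n \<in> ideal_span S X"
    and "\<And>b. b \<in> S \<Longrightarrow> \<exists>c. b - (\<lambda>_. c) \<in> ideal_span S Y"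
  shows "\<exists>E. finite E \<and> E \<subseteq> S \<and> (\<forall>b\<in>S. \<exists>e\<in>lin_span E. b - e \<in> ideal_span S X)"
proof -
  let ?P = "\<lambda>I. \<exists>E. finite E \<and> E \<subseteq> S \<and> (\<forall>b\<in>S. \<exists>e\<in>lin_span E. b - e \<in> ideal_span S I)"
  have "?P (Y \<union> X) \<Longrightarrow> ?P X"
    using assms(1-3)
  proof (induction Y rule: finite_induct)
    case empty
    then show ?case by simp
  next
    case (insert y Y)
    obtain E where E: "finite E" "E \<subseteq> S"
      "\<And>b. b \<in> S \<Longrightarrow> \<exists>e\<in>lin_span E. b - e \<in> ideal_span S (insert y (Y \<union> X))"
      using insert.prems(1) unfolding Un_insert_left by blast
    obtain n where "y ^ n \<in> ideal_span S X" using insert.prems(3) by blast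
    then have "y ^ n \<in> ideal_span S (Y \<union> X)" using ideal_span_mono[of S S X "Y \<union> X"] by blast
    then have "?P (Y \<union> X)" using finite_codim_remove[OF _ _ E] insert.prems(2) by blast
    then show ?case using insert.IH insert.prems(2,3) by blast
  qed
  moreover have "\<exists>e\<in>lin_span {\<lambda>_. 1}. b - e \<in> ideal_span S (Y \<union> X)" if b: "b \<in> S" for b
  proof -
    obtain c where "b - (\<lambda>_. c) \<in> ideal_span S Y" using assms(4)[OF b] by blast
    then have "b - (\<lambda>_. c) \<in> ideal_span S (Y \<union> X)" using ideal_span_mono[of S S Y "Y \<union> X"] by blast
    moreover have "(\<lambda>_. c) * (\<lambda>_. 1) \<in> lin_span {\<lambda>_. 1 :: complex}"
      by (intro lin_span_scale constants.span_base) simp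
    ultimately show ?thesis by (intro bexI[of _ "\<lambda>_. c"]) (auto simp: times_fun_def)
  qed
  then have "?P (Y \<union> X)"
    by (intro exI[of _ "{\<lambda>_. 1}"]) (auto intro: const_mem)
  ultimately show ?thesis by blast
qed

end

subsection \<open>Finite orbits\<close>

lemma eq_0_if_all_powers_dvd:
  fixes P :: "complex poly"
  assumes "\<And>k. [:0, 1:] ^ k dvd P"
  shows "P = 0"
proof (rule ccontr)
  assume "P \<noteq> 0"
  then have "degree ([:0, 1 :: complex:] ^ Suc (degree P)) \<le> degree P"
    by (intro dvd_imp_degree_le assms)
  then show False by (simp add: degree_power_eq)
qed

text \<open>
  The vectors are simultaneous eigenvectors, up to any power of the variable, of matrices with
  distinct eigenvalues; eigenvectors to distinct eigenvalues are linearly independent.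
\<close>

lemma card_le_of_approximate_eigenvectors:
  fixes V :: "'t \<Rightarrow> 'i \<Rightarrow> complex poly" and H :: "'t \<Rightarrow> complex poly"
  assumes "finite I" "finite T" "inj_on H T" and one: "i0 \<in> I" "\<And>t. t \<in> T \<Longrightarrow> V t i0 = 1"
    and eigen: "\<And>k i. i \<in> I \<Longrightarrow>
      \<exists>\<alpha>. \<forall>t\<in>T. [:0, 1:] ^ k dvd H t * V t i - (\<Sum>j\<in>I. \<alpha> j * V t j)"
  shows "card T \<le> card I"
proof (rule ccontr)
  define rel where "rel c \<longleftrightarrow> (\<forall>i\<in>I. (\<Sum>t\<in>T. c t * V t i) = 0)" for c :: "'t \<Rightarrow> complex poly"
  define supp where "supp c = {t \<in> T. c t \<noteq> 0}" for c :: "'t \<Rightarrow> complex poly"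
  \<comment> \<open>For each k the scaled sum agrees, up to a multiple of z^k, with a matrix row
    applied to the relation, that is with 0. The row depends on k, but the sum under test does not,
    so it is exactly zero.\<close>
  have rel_H: "rel (\<lambda>t. c t * H t)" if c: "rel c" for c
    unfolding rel_def
  proof
    fix i assume i: "i \<in> I"
    show "(\<Sum>t\<in>T. c t * H t * V t i) = 0"
    proof (rule eq_0_if_all_powers_dvd)
      fix k
      obtain \<alpha> where \<alpha>: "\<forall>t\<in>T. [:0, 1:] ^ k dvd H t * V t i - (\<Sum>j\<in>I. \<alpha> j * V t j)"
        using eigen[OF i] by blast
      have "(\<Sum>t\<in>T. c t * (\<Sum>j\<in>I. \<alpha> j * V t j)) = (\<Sum>t\<in>T. \<Sum>j\<in>I. \<alpha> j * (c t * V t j))"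
        by (simp add: sum_distrib_left mult.left_commute)
      also have "\<dots> = (\<Sum>j\<in>I. \<alpha> j * (\<Sum>t\<in>T. c t * V t j))"
        by (subst sum.swap) (simp add: sum_distrib_left)
      also have "\<dots> = 0" using c unfolding rel_def by simp
      finally have "(\<Sum>t\<in>T. c t * H t * V t i)
          = (\<Sum>t\<in>T. c t * (H t * V t i - (\<Sum>j\<in>I. \<alpha> j * V t j)))"
        by (simp add: right_diff_distrib sum_subtractf mult.assoc)
      also have "[:0, 1:] ^ k dvd \<dots>" using \<alpha> by (intro dvd_sum dvd_mult) blast
      finally show "[:0, 1:] ^ k dvd (\<Sum>t\<in>T. c t * H t * V t i)" .
    qed
  qed
  assume "\<not> card T \<le> card I"
  then obtain c0 where "\<exists>t\<in>T. c0 t \<noteq> 0" "rel c0"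
    using dependent_vectors[OF assms(1,2), of V] unfolding rel_def by auto
  then have "rel c0 \<and> supp c0 \<noteq> {}" unfolding supp_def by blast
  then obtain c where c: "rel c \<and> supp c \<noteq> {}"
    and min: "\<And>d. rel d \<and> supp d \<noteq> {} \<Longrightarrow> card (supp c) \<le> card (supp d)"
    using ex_has_least_nat[of "\<lambda>c. rel c \<and> supp c \<noteq> {}" c0 "\<lambda>c. card (supp c)"] by blast
  obtain t0 where t0: "t0 \<in> T" "c t0 \<noteq> 0" using c unfolding supp_def by blast
  \<comment> \<open>Subtracting \<open>H t0\<close> times the relation kills the entry at
    \<open>t0\<close> and adds none. As the support of \<open>c\<close> is minimal, \<open>d\<close>
    vanishes, which leaves \<open>t0\<close> as the only entry of \<open>c\<close>; coordinate
    \<open>i0\<close>, where all vectors are 1, excludes that.\<close>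
  define d where "d t = c t * H t - H t0 * c t" for t
  have "rel d"
  proof -
    have "(\<Sum>t\<in>T. d t * V t i) = 0" if "i \<in> I" for i
    proof -
      have "(\<Sum>t\<in>T. d t * V t i) = (\<Sum>t\<in>T. c t * H t * V t i) - H t0 * (\<Sum>t\<in>T. c t * V t i)"
        by (simp add: d_def left_diff_distrib sum_subtractf sum_distrib_left mult.assoc)
      then show ?thesis using rel_H[of c] c that unfolding rel_def by simp
    qed
    then show ?thesis unfolding rel_def by blast
  qed
  have "supp d \<subset> supp c" unfolding supp_def d_def using t0 by auto
  then have "card (supp d) < card (supp c)"
    using \<open>finite T\<close> unfolding supp_def by (intro psubset_card_mono) auto
  then have "supp d = {}" using min[of d] \<open>rel d\<close> by auto
  have other: "c t = 0" if "t \<in> T" "t \<noteq> t0" for t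
  proof (rule ccontr)
    assume "c t \<noteq> 0"
    have "c t * (H t - H t0) = 0" using \<open>supp d = {}\<close> that(1)
      unfolding supp_def d_def by (auto simp: algebra_simps)
    then have "H t = H t0" using \<open>c t \<noteq> 0\<close> by simp
    then show False using assms(3) that t0(1) by (auto dest: inj_onD)
  qed
  have "(\<Sum>t\<in>T. c t * V t i0) = (\<Sum>t\<in>T. if t = t0 then c t0 else 0)"
    using other one(2) by (intro sum.cong) auto
  also have "\<dots> = c t0" using t0 \<open>finite T\<close> by simp
  finally show False using c t0 one(1) unfolding rel_def by simp
qed

context complex_vector_space
begin

lemma polynomial_comp_GL:
  assumes "G \<subseteq> carrier (GL s)" "g \<in> G" "f \<in> R"
  shows "f \<circ> g \<in> R"
  using polynomial_comp[of g f] assms by (auto simp: GL_def o_def)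

text \<open>
  Completing along the fibre: modulo any power of the ideal of the base point, multiplication by an
  invariant of the small group is given by a matrix over the invariants of the large group, so its
  translates are eigenvalues of one and the same matrix.
\<close>

lemma finite_orbit:
  assumes G': "G' \<subseteq> carrier (GL s)"
    and AB: "invariants s G' \<subseteq> invariants s G"
    and E: "finite E" "E \<subseteq> invariants s G"
    and codim: "\<And>b. b \<in> invariants s G \<Longrightarrow>
      \<exists>e\<in>lin_span E. b - e \<in> ideal_span (invariants s G) {a \<in> invariants s G'. a v = 0}"
    and f: "f \<in> invariants s G"
  shows "finite ((\<lambda>g. f \<circ> g) ` G')"
proof (rule ccontr)
  let ?A = "invariants s G'" and ?B = "invariants s G"
  let ?O = "(\<lambda>g. f \<circ> g) ` G'"
  interpret A: function_algebra ?A by (rule function_algebra_invariants)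
  interpret B: function_algebra ?B by (rule function_algebra_invariants)
  define m where "m = {a \<in> ?A. a v = 0}"
  \<comment> \<open>Adjoining 1 gives each eigenvector below an entry equal to 1.\<close>
  define I where "I = insert 1 E"
  have I: "finite I" "I \<subseteq> ?B" "1 \<in> I" using E B.one_mem by (auto simp: I_def)
  have codim': "\<exists>e\<in>lin_span I. b - e \<in> ideal_span ?B m" if "b \<in> ?B" for b
    using codim[OF that] ideal_span_mono[of constants constants E I] unfolding m_def I_def by blast
  have comp: "q \<circ> g \<in> R" if "q \<in> R" "g \<in> G'" for q g
    by (rule polynomial_comp_GL[OF G' that(2,1)])
  have A_comp: "a \<circ> g = a" if "a \<in> ?A" "g \<in> G'" for a g
    using that by (auto simp: invariants_def fun_eq_iff)
  \<comment> \<open>A substitute for the k-th power of the extended ideal of \<open>m\<close>: all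
    translates must vanish to order k at \<open>v\<close> along every line. Translates enter the
    definition because \<open>G'\<close> may move \<open>v\<close>.\<close>
  define Q where "Q k = {q \<in> R. \<forall>g\<in>G'. \<forall>w. [:0, 1:] ^ k dvd line v w (q \<circ> g)}" for k :: nat
  have Q0: "q \<in> Q 0" if "q \<in> R" for q using that by (simp add: Q_def)
  have Q_add: "p + q \<in> Q k" if "p \<in> Q k" "q \<in> Q k" for p q k
  proof -
    have "line v w ((p + q) \<circ> g) = line v w (p \<circ> g) + line v w (q \<circ> g)" if "g \<in> G'" for g w
    proof -
      have "(p + q) \<circ> g = (p \<circ> g) + (q \<circ> g)" by auto
      then show ?thesis
        using \<open>p \<in> Q k\<close> \<open>q \<in> Q k\<close> that by (simp add: line_add comp Q_def)
    qed
    then show ?thesis using that by (auto simp: Q_def intro: R.add_mem dvd_add)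
  qed
  have Q_zero: "0 \<in> Q k" for k
  proof -
    have "line v w (0 \<circ> g) = 0" for g :: "'v \<Rightarrow> 'v" and w
    proof -
      have "(0 :: 'v \<Rightarrow> complex) \<circ> g = 0" by auto
      then show ?thesis by (metis line_eqI R.zero_mem poly_0 zero_fun_apply)
    qed
    then show ?thesis by (simp add: Q_def R.zero_mem)
  qed
  have Q_Suc: "a * q \<in> Q (Suc k)" if a: "a \<in> m" and q: "q \<in> Q k" for a q k
  proof -
    have aA: "a \<in> ?A" "a v = 0" using a by (auto simp: m_def)
    have aR: "a \<in> R" using aA invariants_subset by blast
    have qR: "q \<in> R" using q by (simp add: Q_def)
    have "[:0, 1:] ^ Suc k dvd line v w ((a * q) \<circ> g)" if g: "g \<in> G'" for g w
    proof -
      have "(a * q) \<circ> g = a * (q \<circ> g)" using A_comp[OF aA(1) g] by (auto simp: fun_eq_iff)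
      then have "line v w ((a * q) \<circ> g) = line v w a * line v w (q \<circ> g)"
        using aR comp[OF qR g] by (simp add: line_mult)
      moreover have "poly (line v w a) 0 = 0" using aA by (simp add: poly_line[OF aR])
      then have "[:0, 1:] dvd line v w a" by (simp add: poly_eq_0_iff_dvd)
      moreover have "[:0, 1:] ^ k dvd line v w (q \<circ> g)" using q g unfolding Q_def by blast
      ultimately show ?thesis by (metis mult_dvd_mono power_Suc)
    qed
    then show ?thesis using aR qR by (auto simp: Q_def intro: R.mult_mem)
  qed
  define N where "N k = {b. \<exists>\<alpha>. (\<forall>e\<in>I. \<alpha> e \<in> ?A) \<and> b - (\<Sum>e\<in>I. \<alpha> e * e) \<in> Q k}" for k
  have N_D: "\<exists>\<alpha>. (\<forall>e\<in>I. \<alpha> e \<in> ?A) \<and> b - (\<Sum>e\<in>I. \<alpha> e * e) \<in> Q k" if "b \<in> N k" for b k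
    using that unfolding N_def by (rule CollectD)
  have N_add: "b + b' \<in> N k" if "b \<in> N k" "b' \<in> N k" for b b' k
  proof -
    obtain \<alpha> where \<alpha>: "\<forall>e\<in>I. \<alpha> e \<in> ?A" "b - (\<Sum>e\<in>I. \<alpha> e * e) \<in> Q k"
      using N_D[OF \<open>b \<in> N k\<close>] by (elim exE conjE)
    obtain \<beta> where \<beta>: "\<forall>e\<in>I. \<beta> e \<in> ?A" "b' - (\<Sum>e\<in>I. \<beta> e * e) \<in> Q k"
      using N_D[OF \<open>b' \<in> N k\<close>] by (elim exE conjE)
    have eq: "b + b' - (\<Sum>e\<in>I. (\<alpha> e + \<beta> e) * e)
        = (b - (\<Sum>e\<in>I. \<alpha> e * e)) + (b' - (\<Sum>e\<in>I. \<beta> e * e))"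
      by (simp add: distrib_right sum.distrib)
    have "b + b' - (\<Sum>e\<in>I. (\<alpha> e + \<beta> e) * e) \<in> Q k"
      unfolding eq by (rule Q_add[OF \<alpha>(2) \<beta>(2)])
    moreover have "\<forall>e\<in>I. \<alpha> e + \<beta> e \<in> ?A" using \<alpha>(1) \<beta>(1) by (blast intro: A.add_mem)
    ultimately show ?thesis unfolding N_def by (intro CollectI exI[of _ "\<lambda>e. \<alpha> e + \<beta> e"] conjI)
  qed
  have N_all: "b \<in> N k" if "b \<in> ?B" for b k
    using that
  proof (induction k arbitrary: b)
    case 0
    have "b \<in> Q 0" using 0 invariants_subset by (intro Q0) blast
    then have "b - (\<Sum>e\<in>I. 0 * e) \<in> Q 0" by simp
    then show ?case unfolding N_def using A.zero_mem by (intro CollectI exI[of _ "\<lambda>_. 0"]) blast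
  next
    case (Suc k)
    \<comment> \<open>In \<open>c * a\<close> with \<open>a\<close> in \<open>m\<close>, the factor
      \<open>c\<close> is expanded to order \<open>k\<close>; multiplication by \<open>a\<close>
      raises the order of the error by one and keeps the coefficients in the invariants of
      \<open>G'\<close>.\<close>
    have N_ideal: "x \<in> N (Suc k)" if "x \<in> ideal_span ?B m" for x
      using that
    proof induction
      case zero
      have "0 - (\<Sum>e\<in>I. 0 * e) \<in> Q (Suc k)" using Q_zero by simp
      then show ?case unfolding N_def using A.zero_mem by (intro CollectI exI[of _ "\<lambda>_. 0"]) blast
    next
      case (step c a x)
      obtain \<alpha> where \<alpha>: "\<forall>e\<in>I. \<alpha> e \<in> ?A" "c - (\<Sum>e\<in>I. \<alpha> e * e) \<in> Q k"
        using N_D[OF Suc.IH[OF step(1)]] by (elim exE conjE)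
      have "a * (c - (\<Sum>e\<in>I. \<alpha> e * e)) \<in> Q (Suc k)" by (rule Q_Suc[OF step(2) \<alpha>(2)])
      moreover have "a * (c - (\<Sum>e\<in>I. \<alpha> e * e)) = c * a - (\<Sum>e\<in>I. (a * \<alpha> e) * e)"
        by (simp add: right_diff_distrib sum_distrib_left mult.assoc mult.commute[of a c])
      moreover have "\<forall>e\<in>I. a * \<alpha> e \<in> ?A"
        using step(2) \<alpha>(1) unfolding m_def by (blast intro: A.mult_mem)
      ultimately have "c * a \<in> N (Suc k)"
        unfolding N_def by (intro CollectI exI[of _ "\<lambda>e. a * \<alpha> e"]) simp
      then show ?case using step.IH by (rule N_add)
    qed
    obtain e where e: "e \<in> lin_span I" "b - e \<in> ideal_span ?B m" using codim'[OF Suc.prems] by blast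
    obtain c where "e = (\<Sum>y\<in>I. (\<lambda>_. c y) * y)"
      using e(1) unfolding lin_span_finite_iff[OF I(1)] by blast
    then have "e - (\<Sum>y\<in>I. (\<lambda>_. c y) * y) \<in> Q (Suc k)" using Q_zero by simp
    then have "e \<in> N (Suc k)"
      unfolding N_def using A.const_mem by (intro CollectI exI[of _ "\<lambda>y _. c y"]) blast
    then have "(b - e) + e \<in> N (Suc k)" using N_ideal[OF e(2)] by (intro N_add)
    then show ?case by simp
  qed
  assume "infinite ?O"
  then obtain T where T: "T \<subseteq> ?O" "finite T" "card T = Suc (card I)"
    using infinite_arbitrarily_large by blast
  have fR: "f \<in> R" using f invariants_subset by blast
  have "\<forall>t. \<exists>g. t \<in> T \<longrightarrow> g \<in> G' \<and> t = f \<circ> g" using T(1) by blast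
  then obtain \<gamma> where \<gamma>: "\<And>t. t \<in> T \<Longrightarrow> \<gamma> t \<in> G'" "\<And>t. t \<in> T \<Longrightarrow> f \<circ> \<gamma> t = t" by metis
  have TR: "T \<subseteq> R" using comp[OF fR] T(1) by blast
  \<comment> \<open>The line from \<open>v\<close> to \<open>u\<close> keeps the chosen translates
    distinct: their restrictions already differ at parameter 1.\<close>
  obtain u where u: "inj_on (\<lambda>h. h u) T" using separating_point[OF T(2) TR] by blast
  define w where "w = u - v"
  define V where "V t e = line v w (e \<circ> \<gamma> t)" for t e
  define H where "H t = line v w t" for t
  have H_u: "poly (H t) 1 = t u" if "t \<in> T" for t
    using TR that unfolding H_def by (subst poly_line) (auto simp: w_def)
  have "inj_on H T"
  proof (rule inj_onI)
    fix x y assume xy: "x \<in> T" "y \<in> T" "H x = H y"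
    then have "x u = y u" using H_u by metis
    then show "x = y" using u xy by (auto dest: inj_onD)
  qed
  moreover have "V t 1 = 1" if "t \<in> T" for t
  proof -
    have "(1 :: 'v \<Rightarrow> complex) \<circ> \<gamma> t = 1" by auto
    then show ?thesis unfolding V_def by (intro line_eqI) (auto simp: R.one_mem)
  qed
  moreover have "\<exists>\<alpha>. \<forall>t\<in>T. [:0, 1:] ^ k dvd H t * V t e - (\<Sum>j\<in>I. \<alpha> j * V t j)"
    if e: "e \<in> I" for k e
  proof -
    \<comment> \<open>One expansion of \<open>f * e\<close> serves all translates: composition with
      \<open>\<gamma> t\<close> turns \<open>f\<close> into \<open>t\<close> and \<open>j\<close>
      into its translate, but fixes the coefficients.\<close>
    have "f * e \<in> N k" using f I(2) e by (intro N_all B.mult_mem) blast+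
    from N_D[OF this] obtain \<alpha> where \<alpha>': "\<forall>j\<in>I. \<alpha> j \<in> ?A" and \<alpha>2: "f * e - (\<Sum>j\<in>I. \<alpha> j * j) \<in> Q k"
      by (elim exE conjE)
    note \<alpha> = bspec[OF \<alpha>'] \<alpha>2
    have IR: "j \<in> R" if "j \<in> I" for j using that I(2) invariants_subset by blast
    have \<alpha>R: "\<alpha> j \<in> R" if "j \<in> I" for j using that \<alpha>(1) invariants_subset by blast
    have "[:0, 1:] ^ k dvd H t * V t e - (\<Sum>j\<in>I. line v w (\<alpha> j) * V t j)" if t: "t \<in> T" for t
    proof -
      have tg: "\<gamma> t \<in> G'" by (rule \<gamma>(1)[OF t])
      have "(f * e - (\<Sum>j\<in>I. \<alpha> j * j)) \<circ> \<gamma> t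
          = t * (e \<circ> \<gamma> t) - (\<Sum>j\<in>I. (\<alpha> j * j) \<circ> \<gamma> t)"
      proof
        fix x
        have "t x = f (\<gamma> t x)" using \<gamma>(2)[OF t] by (metis o_apply)
        then show "((f * e - (\<Sum>j\<in>I. \<alpha> j * j)) \<circ> \<gamma> t) x
          = (t * (e \<circ> \<gamma> t) - (\<Sum>j\<in>I. (\<alpha> j * j) \<circ> \<gamma> t)) x" by (simp add: sum_fun_apply)
      qed
      also have "(\<Sum>j\<in>I. (\<alpha> j * j) \<circ> \<gamma> t) = (\<Sum>j\<in>I. \<alpha> j * (j \<circ> \<gamma> t))"
      proof (intro sum.cong refl)
        fix j assume "j \<in> I"
        from A_comp[OF \<alpha>(1)[OF this] tg] show "(\<alpha> j * j) \<circ> \<gamma> t = \<alpha> j * (j \<circ> \<gamma> t)"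
          by (auto simp: fun_eq_iff)
      qed
      finally have eq: "(f * e - (\<Sum>j\<in>I. \<alpha> j * j)) \<circ> \<gamma> t
          = t * (e \<circ> \<gamma> t) - (\<Sum>j\<in>I. \<alpha> j * (j \<circ> \<gamma> t))" .
      have tR: "t \<in> R" using TR t by blast
      have R1: "t * (e \<circ> \<gamma> t) \<in> R" by (rule R.mult_mem[OF tR comp[OF IR[OF e] tg]])
      have R2: "\<alpha> j * (j \<circ> \<gamma> t) \<in> R" if "j \<in> I" for j
        by (rule R.mult_mem[OF \<alpha>R[OF that] comp[OF IR[OF that] tg]])
      have "line v w ((f * e - (\<Sum>j\<in>I. \<alpha> j * j)) \<circ> \<gamma> t)
          = line v w (t * (e \<circ> \<gamma> t)) - line v w (\<Sum>j\<in>I. \<alpha> j * (j \<circ> \<gamma> t))"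
        unfolding eq by (intro line_diff R1 R.sum_mem R2)
      also have "line v w (t * (e \<circ> \<gamma> t)) = H t * V t e"
        unfolding H_def V_def by (intro line_mult tR comp IR e tg)
      also have "line v w (\<Sum>j\<in>I. \<alpha> j * (j \<circ> \<gamma> t)) = (\<Sum>j\<in>I. line v w (\<alpha> j * (j \<circ> \<gamma> t)))"
        by (intro line_sum R2)
      also have "\<dots> = (\<Sum>j\<in>I. line v w (\<alpha> j) * V t j)"
        unfolding V_def by (intro sum.cong refl line_mult \<alpha>R comp IR tg)
      finally have "line v w ((f * e - (\<Sum>j\<in>I. \<alpha> j * j)) \<circ> \<gamma> t)
          = H t * V t e - (\<Sum>j\<in>I. line v w (\<alpha> j) * V t j)" .
      moreover have "[:0, 1:] ^ k dvd line v w ((f * e - (\<Sum>j\<in>I. \<alpha> j * j)) \<circ> \<gamma> t)"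
        using \<alpha>(2) tg unfolding Q_def by blast
      ultimately show ?thesis by simp
    qed
    then show ?thesis by (intro exI[of _ "\<lambda>j. line v w (\<alpha> j)"]) blast
  qed
  ultimately have "card T \<le> card I"
    by (intro card_le_of_approximate_eigenvectors[OF I(1) T(2) _ I(3), of H V])
  then show False using T(3) by simp
qed

text \<open>With finitely many values, the level set of \<open>p h\<close> and its complement in
  \<open>G'\<close> are both relatively open: \<open>p\<close> minus \<open>p h\<close> is nonzero
  exactly on the complement, and the product \<open>r\<close> over the other values is nonzero
  exactly on the level set.\<close>

lemma connected_finite_values:
  assumes conn: "connectedin (zariski_GL s) G'" and G': "G' \<subseteq> carrier (GL s)"
    and p: "p \<in> regular_functions_GL s" and fin: "finite (p ` G')"
    and gh: "g \<in> G'" "h \<in> G'"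
  shows "p g = p h"
proof -
  interpret P: function_algebra "regular_functions_GL s"
    unfolding regular_functions_GL_def by (rule function_algebra_generated)
  define r where "r = (\<Prod>c\<in>p ` G' - {p h}. p - (\<lambda>_. c))"
  have prod_mem: "(\<Prod>c\<in>C. p - (\<lambda>_. c)) \<in> regular_functions_GL s" if "finite C" for C
    using that
  proof (induction C rule: finite_induct)
    case empty
    then show ?case by (simp only: prod.empty P.one_mem)
  next
    case (insert c C)
    show ?case unfolding prod.insert[OF insert.hyps]
      by (rule P.mult_mem[OF P.diff_mem[OF p P.const_mem] insert.IH])
  qed
  have r_mem: "r \<in> regular_functions_GL s" unfolding r_def using fin by (intro prod_mem) simp
  have r_apply: "r x = (\<Prod>c\<in>p ` G' - {p h}. p x - c)" for x
  proof -
    have "(\<Prod>c\<in>C. p - (\<lambda>_. c)) x = (\<Prod>c\<in>C. p x - c)" if "finite C" for C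
      using that by (induction C) auto
    then show ?thesis unfolding r_def using fin by simp
  qed
  have r0: "r x = 0 \<longleftrightarrow> p x \<noteq> p h" if "x \<in> G'" for x
    unfolding r_apply using that fin by auto
  define E1 E2 where "E1 = {x \<in> carrier (GL s). (p - (\<lambda>_. p h)) x \<noteq> 0}"
    and "E2 = {x \<in> carrier (GL s). r x \<noteq> 0}"
  have "openin (zariski_GL s) {x \<in> carrier (GL s). q x \<noteq> 0}" if "q \<in> regular_functions_GL s" for q
    unfolding zariski_GL_def using that by (intro topology_generated_by_Basis) blast
  then have "openin (zariski_GL s) E1" "openin (zariski_GL s) E2"
    unfolding E1_def E2_def using r_mem P.diff_mem[OF p P.const_mem] by blast+
  moreover have "G' \<subseteq> E1 \<union> E2" "E1 \<inter> E2 \<inter> G' = {}" "E2 \<inter> G' \<noteq> {}"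
    using G' gh(2) by (auto simp: E1_def E2_def r0)
  ultimately have "E1 \<inter> G' = {}" using conn unfolding connectedin by blast
  then show ?thesis using G' gh(1) by (auto simp: E1_def)
qed

end

section \<open>From a common fibre to equality of the invariant rings\<close>

theorem theorem2p1:
  fixes s :: "complex \<Rightarrow> 'v::ab_group_add \<Rightarrow> 'v"
    and Basis :: "'v set"
    and G G' :: "('v \<Rightarrow> 'v) set"
    and F :: "'v set"
  assumes "finite_dimensional_vector_space s Basis"
    and "reductive_group s G"
    and "reductive_group s G'"
    and "G \<subseteq> G'"
    and "connectedin (zariski_GL s) G'"
    and "is_quotient_fiber s G F"
    and "is_quotient_fiber s G' F"
  shows "invariants s G = invariants s G'"
proof -
  interpret finite_dimensional_vector_space s Basis by fact
  interpret complex_vector_space s Basis ..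
  let ?A = "invariants s G'" and ?B = "invariants s G"
  interpret A: function_algebra ?A by (rule function_algebra_invariants)
  interpret B: function_algebra ?B by (rule function_algebra_invariants)
  have AB: "?A \<subseteq> ?B" using assms(4) by (auto simp: invariants_def)
  have sub: "subgroup G' (GL s)" using assms(3) unfolding reductive_group_def by blast
  then have G': "G' \<subseteq> carrier (GL s)" by (rule subgroup.subset)
  have id: "id \<in> G'" using subgroup.one_closed[OF sub] by (simp add: GL_def)
  obtain v where v: "v \<in> F" using fibre_nonempty[OF assms(2,6)] by blast
  define mA mB where "mA = {a \<in> ?A. a v = 0}" and "mB = {b \<in> ?B. b v = 0}"
  have mA_R: "mA \<subseteq> R" and mB_R: "mB \<subseteq> R" and mB_B: "mB \<subseteq> ?B" and mA_B: "mA \<subseteq> ?B"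
    unfolding mA_def mB_def using AB invariants_subset by blast+
  have contract: "b \<in> ideal_span ?B X" if b: "b \<in> ?B" "b \<in> ideal_span R X" and X: "X \<subseteq> ?B" for b X
  proof -
    obtain Y where Y: "Y \<subseteq> X" "finite Y" "b \<in> ideal_span R Y"
      using ideal_span_finite_support[OF b(2)] by blast
    then have "b \<in> ideal_span ?B Y" using invariants_contract[OF assms(2) Y(2) _ b(1)] X by blast
    then show ?thesis using ideal_span_mono[OF order.refl Y(1)] by blast
  qed
  \<comment> \<open>The common zeros of \<open>mA\<close> form the fibre of the larger group's
    quotient map, which is \<open>F\<close>; being also a fibre for \<open>G\<close>, it lies in the
    zero set of \<open>mB\<close>.\<close>
  have nilp: "\<exists>n. y ^ n \<in> ideal_span ?B mA" if y: "y \<in> mB" for y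
  proof -
    have yB: "y \<in> ?B" "y v = 0" using y unfolding mB_def by blast+
    have "\<exists>n. y ^ n \<in> ideal_span R mA"
    proof (rule nullstellensatz_R[OF mA_R])
      show "y \<in> R" using y mB_R by blast
      fix x assume x: "\<And>p. p \<in> mA \<Longrightarrow> p x = 0"
      have "a x = a v" if a: "a \<in> ?A" for a
      proof -
        have "a - (\<lambda>_. a v) \<in> mA" unfolding mA_def using A.diff_mem[OF a A.const_mem] by simp
        from x[OF this] show ?thesis by simp
      qed
      then have "x \<in> F" using fibre_eq[OF assms(7) v] by blast
      then have "y x = y v" using fibre_eq[OF assms(6) v] yB(1) by blast
      then show "y x = 0" using yB(2) by simp
    qed
    then show ?thesis using contract[OF B.power_mem[OF yB(1)] _ mA_B] by blast
  qed
  \<comment> \<open>Finiteness comes from Noetherianity of \<open>R\<close>; contraction then makes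
    \<open>Y\<close> generate \<open>mB\<close> within the invariants of \<open>G\<close>.\<close>
  obtain Y where Y: "Y \<subseteq> mB" "finite Y" "mB \<subseteq> ideal_span R Y"
    using noetherian_R mB_R unfolding noetherian_def by meson
  have YB: "Y \<subseteq> ?B" using Y(1) mB_B by blast
  have const: "\<exists>c. b - (\<lambda>_. c) \<in> ideal_span ?B Y" if b: "b \<in> ?B" for b
  proof -
    have "b - (\<lambda>_. b v) \<in> mB" unfolding mB_def using B.diff_mem[OF b B.const_mem] by simp
    then show ?thesis using contract[OF _ _ YB] Y(3) mB_B by blast
  qed
  have "\<exists>E. finite E \<and> E \<subseteq> ?B \<and> (\<forall>b\<in>?B. \<exists>e\<in>lin_span E. b - e \<in> ideal_span ?B mA)"
  proof (rule B.finite_codim[OF Y(2) YB])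
    show "\<exists>n. y ^ n \<in> ideal_span ?B mA" if "y \<in> Y" for y
      using nilp Y(1) that by blast
  qed (rule const)
  then obtain E where
    E: "finite E" "E \<subseteq> ?B" "\<forall>b\<in>?B. \<exists>e\<in>lin_span E. b - e \<in> ideal_span ?B mA"
    by (elim exE conjE)
  have "f \<in> ?A" if f: "f \<in> ?B" for f
  proof -
    have "finite ((\<lambda>g. f \<circ> g) ` G')"
      by (rule finite_orbit[OF G' AB E(1,2) bspec[OF E(3)[unfolded mA_def]] f])
    have fR: "f \<in> R" using f invariants_subset by blast
    have "f (g x) = f x" if g: "g \<in> G'" for g x
    proof -
      \<comment> \<open>At a fixed point \<open>x\<close> the finite orbit gives a regular function
        of \<open>g\<close> with finitely many values, so connectedness applies pointwise.\<close>
      have "(\<lambda>g. f (g x)) ` G' = (\<lambda>h. h x) ` (\<lambda>g. f \<circ> g) ` G'" by (auto simp: image_image)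
      then have "finite ((\<lambda>g. f (g x)) ` G')" using \<open>finite ((\<lambda>g. f \<circ> g) ` G')\<close> by simp
      from connected_finite_values[OF assms(5) G' regular_matrix_coeff[OF fR] this g id]
      show ?thesis by simp
    qed
    then show ?thesis using fR by (simp add: invariants_def)
  qed
  then show ?thesis using AB by blast
qed

end
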